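(* Suppose $r=0$ (so $X_1,X_2$ are objectively independent), let $\gamma>0$ and $c\in\mathbb R$. The solution of $$\min_{\mu_1,\mu_2\in\mathbb R,\ \sigma_1^2,\sigma_2^2\ge0} D_{KL}\big(\mathcal H^\bullet(c)\,\|\,\mathcal H(\Psi(\mu_1,\mu_2,\sigma_1^2,\sigma_2^2;\gamma);c)\big)$$ is $\mu_1^*(c)=\mu_1^\bullet$, $\mu_2^*(c)=\mu_2^\bullet-\gamma\big(\mu_1^\bullet-\mathbb E[X_1\mid X_1\le c]\big)$, $(\sigma_1^* )^2(c)=(\sigma^\bullet)^2$, and $(\sigma_2^* )^2(c)=(\sigma^\bullet)^2+\gamma^2\,\mathrm{Var}[X_1\mid X_1\le c]$, where expectation and variance are under the true law $X_1\sim\mathcal N(\mu_1^\bullet,(\sigma^\bullet)^2)$. Consequently $(\sigma_2^* )^2(c)$ is strictly increasing in $c$.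
   Context: $\phi(\cdot\mid\mu,\sigma^2)$ is the density of $\mathcal N(\mu,\sigma^2)$. Fix $\mu_1^\bullet,\mu_2^\bullet\in\mathbb R$ and $(\sigma^\bullet)^2>0$. $\Psi(\mu_1,\mu_2,\sigma_1^2,\sigma_2^2;\gamma)$ is the joint law with $X_1\sim\mathcal N(\mu_1,\sigma_1^2)$ and $X_2\mid(X_1=x_1)\sim\mathcal N(\mu_2-\gamma(x_1-\mu_1),\sigma_2^2)$. The true law is $\Psi(\mu_1^\bullet,\mu_2^\bullet,(\sigma^\bullet)^2,(\sigma^\bullet)^2;0)$. $\mathcal H(\Psi;c)$ is the law of the history when $(X_1,X_2)\sim\Psi$ and $X_2$ is censored (unobserved) whenever $X_1>c$; $\mathcal H^\bullet(c)$ is this law under the true law. The KL divergence is $$\int_c^\infty\phi(x_1\mid\mu_1^\bullet,(\sigma^\bullet)^2)\ln\frac{\phi(x_1\mid\mu_1^\bullet,(\sigma^\bullet)^2)}{\phi(x_1\mid\mu_1,\sigma_1^2)}dx_1+\int_{-\infty}^c\int_{-\infty}^\infty\phi(x_1\mid\mu_1^\bullet,(\sigma^\bullet)^2)\phi(x_2\mid\mu_2^\bullet,(\sigma^\bullet)^2)\ln\frac{\phi(x_1\mid\mu_1^\bullet,(\sigma^\bullet)^2)\phi(x_2\mid\mu_2^\bullet,(\sigma^\bullet)^2)}{\phi(x_1\mid\mu_1,\sigma_1^2)\phi(x_2\mid\mu_2-\gamma(x_1-\mu_1),\sigma_2^2)}dx_2\,dx_1,$$ interpreted as $+\infty$ if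 $\sigma_1^2=0$ or $\sigma_2^2=0$. *)

theory Defs
  imports "HOL-Probability.Probability"
begin

section \<open>Normal laws with possibly zero variance\<close>

abbreviation normal_pdf :: "real \<Rightarrow> real \<Rightarrow> real \<Rightarrow> real" where
  "normal_pdf m v \<equiv> normal_density m (sqrt v)"

text \<open>The second parameter is the variance (not the standard deviation); it is meant to be
  nonnegative, and variance zero gives the point mass.\<close>

definition normal_law :: "real \<Rightarrow> real \<Rightarrow> real measure" where
  "normal_law m v = (if v = 0 then return borel m else density lborel (\<lambda>x. ennreal (normal_pdf m v x)))"

section \<open>The model and the law of the censored history\<close>

definition Psi :: "real \<Rightarrow> real \<Rightarrow> real \<Rightarrow> real \<Rightarrow> real \<Rightarrow> (real \<times> real) measure" where
  "Psi m1 m2 v1 v2 \<gamma> =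
     normal_law m1 v1 \<bind> (\<lambda>x1. normal_law (m2 - \<gamma> * (x1 - m1)) v2 \<bind>
       (\<lambda>x2. return (borel \<Otimes>\<^sub>M borel) (x1, x2)))"

text \<open>The second component of a history is \<^term>\<open>None\<close> if the second draw is unobserved.
  The set of possible second components carries the usual disjoint-union sigma-algebra, i.e. the
  largest one for which \<^term>\<open>Some\<close> is measurable.\<close>

definition option_borel :: "real option measure" where
  "option_borel = sigma UNIV {A. Some -` A \<in> sets borel}"

definition censor :: "real \<Rightarrow> real \<times> real \<Rightarrow> real \<times> real option" where
  "censor c = (\<lambda>(x1, x2). (x1, if x1 > c then None else Some x2))"

definition history :: "(real \<times> real) measure \<Rightarrow> real \<Rightarrow> (real \<times> real option) measure" where
  "history P c = distr P (borel \<Otimes>\<^sub>M option_borel) (censor c)"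

section \<open>Kullback--Leibler divergence\<close>

text \<open>The library constant \<^const>\<open>KL_divergence\<close> is real-valued, takes the reference law first and
  is only meaningful if the first law is dominated by the second one and the log-likelihood ratio
  is integrable; otherwise the divergence of probability measures is infinite.\<close>

definition D_KL :: "'a measure \<Rightarrow> 'a measure \<Rightarrow> ereal" where
  "D_KL P Q =
     (if absolutely_continuous Q P \<and> integrable P (entropy_density (exp 1) Q P)
      then ereal (KL_divergence (exp 1) Q P) else \<infinity>)"

section \<open>Conditional moments of the first draw\<close>

definition cond_mean :: "real measure \<Rightarrow> real set \<Rightarrow> real" where
  "cond_mean P A = (\<integral>x. x \<partial>uniform_measure P A)"

definition cond_var :: "real measure \<Rightarrow> real set \<Rightarrow> real" where
  "cond_var P A = (\<integral>x. (x - cond_mean P A)\<^sup>2 \<partial>uniform_measure P A)"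

section \<open>The divergence in terms of densities\<close>

text \<open>The results \<open>D_KL_history\<close> and \<open>D_KL_history_degenerate\<close> below show that the divergence
  between the two history laws is the explicit integral over the uncensored and censored regions
  if both subjective variances are positive, and infinite if one of them is zero.\<close>

lemma sets_normal_law[measurable_cong, simp]: "sets (normal_law m v) = sets borel"
  by (auto simp: normal_law_def)

lemma space_normal_law[simp]: "space (normal_law m v) = UNIV"
  by (auto simp: normal_law_def)

lemma prob_space_normal_law: "0 \<le> v \<Longrightarrow> prob_space (normal_law m v)"
  by (auto simp: normal_law_def intro!: prob_space_return prob_space_normal_density)

lemma normal_law_affine:
  assumes "0 \<le> v"
  shows "normal_law m v = distr (normal_law 0 1) borel (\<lambda>z. m + sqrt v * z)"
proof (cases "v = 0")
  case True
  interpret N: prob_space "normal_law 0 1" by (rule prob_space_normal_law) simp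
  have "distr (normal_law 0 1) borel (\<lambda>z. m) = return borel m"
    by (intro measure_eqI) (auto simp: emeasure_distr N.emeasure_space_1[simplified] split: split_indicator)
  then show ?thesis using True by (simp add: normal_law_def)
next
  case False
  with assms have v: "v > 0" by simp
  interpret N: prob_space "normal_law 0 1" by (rule prob_space_normal_law) simp
  have "distributed (normal_law 0 1) lborel (\<lambda>x. x) (\<lambda>x. ennreal (normal_density 0 1 x))"
    by (simp add: distributed_def normal_law_def distr_id2)
  from N.normal_density_affine[OF this, of "sqrt v" m] v
  have "distributed (normal_law 0 1) lborel (\<lambda>x. m + sqrt v * x) (normal_density m (sqrt v))"
    by simp
  then have "distr (normal_law 0 1) lborel (\<lambda>x. m + sqrt v * x) = normal_law m v"
    using v by (simp add: distributed_def normal_law_def)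
  then show ?thesis
    using distr_cong[of "normal_law 0 1" "normal_law 0 1" borel lborel "\<lambda>x. m + sqrt v * x"] by simp
qed

lemma measurable_normal_law[measurable]:
  assumes "0 \<le> v" and [measurable]: "f \<in> borel_measurable M"
  shows "(\<lambda>x. normal_law (f x) v) \<in> measurable M (subprob_algebra borel)"
proof -
  have "(\<lambda>x. distr (normal_law 0 1) borel (\<lambda>z. f x + sqrt v * z)) \<in> measurable M (subprob_algebra borel)"
  proof (rule measurable_distr2[where M = borel])
    show "(\<lambda>(x, z). f x + sqrt v * z) \<in> borel_measurable (M \<Otimes>\<^sub>M borel)" by measurable
    show "(\<lambda>x. normal_law 0 1) \<in> measurable M (subprob_algebra borel)"
      by (rule measurable_const)
        (simp add: space_subprob_algebra prob_space_imp_subprob_space prob_space_normal_law)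
  qed
  then show ?thesis using assms by (simp add: normal_law_affine[of v])
qed

lemma measurable_Psi_kernel:
  assumes "0 \<le> v2"
  shows "(\<lambda>x1. normal_law (m2 - \<gamma> * (x1 - m1)) v2 \<bind> (\<lambda>x2. return (borel \<Otimes>\<^sub>M borel) (x1, x2)))
    \<in> measurable borel (subprob_algebra (borel \<Otimes>\<^sub>M borel))"
proof (rule measurable_bind[where N = borel])
  show "(\<lambda>x1. normal_law (m2 - \<gamma> * (x1 - m1)) v2) \<in> measurable borel (subprob_algebra borel)"
    by (rule measurable_normal_law[OF assms]) measurable
  show "(\<lambda>x. return (borel \<Otimes>\<^sub>M borel) (fst x, snd x)) \<in>
      measurable (borel \<Otimes>\<^sub>M borel) (subprob_algebra (borel \<Otimes>\<^sub>M borel))"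
    by (simp add: return_measurable)
qed

lemma sets_Psi[simp]:
  assumes "0 \<le> v2"
  shows "sets (Psi m1 m2 v1 v2 \<gamma>) = sets (borel \<Otimes>\<^sub>M borel)"
  unfolding Psi_def
  by (rule sets_bind) (use measurable_Psi_kernel[OF assms, THEN sets_kernel] in auto)

lemma nn_integral_Psi:
  assumes v: "0 \<le> v2" and h[measurable]: "h \<in> borel_measurable (borel \<Otimes>\<^sub>M borel)"
  shows "(\<integral>\<^sup>+z. h z \<partial>Psi m1 m2 v1 v2 \<gamma>) =
    (\<integral>\<^sup>+x1. \<integral>\<^sup>+x2. h (x1, x2) \<partial>normal_law (m2 - \<gamma> * (x1 - m1)) v2 \<partial>normal_law m1 v1)"
proof -
  have "(\<integral>\<^sup>+z. h z \<partial>Psi m1 m2 v1 v2 \<gamma>) = (\<integral>\<^sup>+x1. \<integral>\<^sup>+z. h z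
      \<partial>(normal_law (m2 - \<gamma> * (x1 - m1)) v2 \<bind> (\<lambda>x2. return (borel \<Otimes>\<^sub>M borel) (x1, x2))) \<partial>normal_law m1 v1)"
    unfolding Psi_def
    using measurable_Psi_kernel[OF v, of m2 \<gamma> m1]
    by (intro nn_integral_bind[OF h]) (subst measurable_cong_sets[OF sets_normal_law refl])
  also have "\<dots> = (\<integral>\<^sup>+x1. \<integral>\<^sup>+x2. h (x1, x2) \<partial>normal_law (m2 - \<gamma> * (x1 - m1)) v2 \<partial>normal_law m1 v1)"
  proof (rule nn_integral_cong)
    fix x1
    let ?N = "normal_law (m2 - \<gamma> * (x1 - m1)) v2"
    have "(\<lambda>x2. return (borel \<Otimes>\<^sub>M borel) (x1, x2)) \<in> measurable ?N (subprob_algebra (borel \<Otimes>\<^sub>M borel))"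
      by (rule measurable_compose[OF _ return_measurable]) measurable
    then have "(\<integral>\<^sup>+z. h z \<partial>(?N \<bind> (\<lambda>x2. return (borel \<Otimes>\<^sub>M borel) (x1, x2)))) =
        (\<integral>\<^sup>+x2. \<integral>\<^sup>+z. h z \<partial>return (borel \<Otimes>\<^sub>M borel) (x1, x2) \<partial>?N)"
      by (rule nn_integral_bind[OF h])
    also have "\<dots> = (\<integral>\<^sup>+x2. h (x1, x2) \<partial>?N)"
      by (intro nn_integral_cong nn_integral_return h) (simp add: space_pair_measure)
    finally show "(\<integral>\<^sup>+z. h z \<partial>(?N \<bind> (\<lambda>x2. return (borel \<Otimes>\<^sub>M borel) (x1, x2)))) =
        (\<integral>\<^sup>+x2. h (x1, x2) \<partial>?N)" .
  qed
  finally show ?thesis .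
qed

lemma prob_space_Psi:
  assumes "0 \<le> v1" "0 \<le> v2"
  shows "prob_space (Psi m1 m2 v1 v2 \<gamma>)"
proof
  have "emeasure (Psi m1 m2 v1 v2 \<gamma>) (space (Psi m1 m2 v1 v2 \<gamma>)) = (\<integral>\<^sup>+z. 1 \<partial>Psi m1 m2 v1 v2 \<gamma>)"
    by simp
  also have "\<dots> = (\<integral>\<^sup>+x1. \<integral>\<^sup>+x2. 1 \<partial>normal_law (m2 - \<gamma> * (x1 - m1)) v2 \<partial>normal_law m1 v1)"
    by (rule nn_integral_Psi[OF assms(2)]) simp
  also have "\<dots> = 1"
    using prob_space.emeasure_space_1[OF prob_space_normal_law[OF assms(1)]]
      prob_space.emeasure_space_1[OF prob_space_normal_law[OF assms(2)]]
    by simp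
  finally show "emeasure (Psi m1 m2 v1 v2 \<gamma>) (space (Psi m1 m2 v1 v2 \<gamma>)) = 1" .
qed

lemma Psi_indep:
  assumes "0 \<le> v1" "0 \<le> v2"
  shows "Psi m1 m2 v1 v2 0 = normal_law m1 v1 \<Otimes>\<^sub>M normal_law m2 v2"
proof -
  interpret A: prob_space "normal_law m1 v1" by (rule prob_space_normal_law) fact
  interpret B: prob_space "normal_law m2 v2" by (rule prob_space_normal_law) fact
  interpret pair_prob_space "normal_law m1 v1" "normal_law m2 v2" ..
  have eq: "return (normal_law m1 v1 \<Otimes>\<^sub>M normal_law m2 v2) = return (borel \<Otimes>\<^sub>M borel)"
    by (intro ext return_cong sets_pair_measure_cong sets_normal_law)
  show ?thesis
    using pair_measure_eq_bind unfolding eq by (simp add: Psi_def)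
qed

lemma sets_option_borel: "sets option_borel = {A. Some -` A \<in> sets borel}"
proof -
  have "sigma_algebra UNIV {A :: real option set. Some -` A \<in> sets borel}"
    unfolding sigma_algebra_iff2
    by (auto simp: vimage_UN vimage_Compl Compl_eq_Diff_UNIV[symmetric] borel_comp)
  then show ?thesis
    unfolding option_borel_def by (simp add: sigma_algebra.sigma_sets_eq)
qed

lemma space_option_borel[simp]: "space option_borel = UNIV"
  by (simp add: option_borel_def)

lemma measurable_Some[measurable]: "Some \<in> measurable borel option_borel"
  by (rule measurableI) (auto simp: sets_option_borel)

lemma measurable_the[measurable]: "the \<in> measurable option_borel borel"
  by (rule measurableI) (auto simp: sets_option_borel vimage_def)

lemma pred_None[measurable]: "Measurable.pred option_borel (\<lambda>x. x = None)"
proof -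
  have "{x. x = None} \<in> sets option_borel" by (simp add: sets_option_borel vimage_def)
  then show ?thesis by (simp add: pred_def)
qed

lemma measurable_censor[measurable]:
  "censor c \<in> measurable (borel \<Otimes>\<^sub>M borel) (borel \<Otimes>\<^sub>M option_borel)"
proof -
  have "censor c = (\<lambda>z. (fst z, if fst z > c then None else Some (snd z)))"
    by (auto simp: censor_def)
  then show ?thesis by simp
qed

lemma sets_history[simp, measurable_cong]: "sets (history P c) = sets (borel \<Otimes>\<^sub>M option_borel)"
  by (simp add: history_def)

lemma measurable_censor_Psi:
  assumes "0 \<le> v2"
  shows "censor c \<in> measurable (Psi m1 m2 v1 v2 \<gamma>) (borel \<Otimes>\<^sub>M option_borel)"
  using measurable_censor by (subst measurable_cong_sets[OF sets_Psi[OF assms] refl])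

lemma nn_integral_history:
  assumes v: "0 \<le> v2" and h[measurable]: "h \<in> borel_measurable (borel \<Otimes>\<^sub>M option_borel)"
  shows "(\<integral>\<^sup>+z. h z \<partial>history (Psi m1 m2 v1 v2 \<gamma>) c) =
    (\<integral>\<^sup>+x1. \<integral>\<^sup>+x2. h (censor c (x1, x2)) \<partial>normal_law (m2 - \<gamma> * (x1 - m1)) v2 \<partial>normal_law m1 v1)"
  unfolding history_def
  using nn_integral_distr[OF measurable_censor_Psi[OF v], of h] nn_integral_Psi[OF v, of "\<lambda>z. h (censor c z)"] by simp

lemma prob_space_history:
  assumes "0 \<le> v1" "0 \<le> v2"
  shows "prob_space (history (Psi m1 m2 v1 v2 \<gamma>) c)"
  unfolding history_def
  by (rule prob_space.prob_space_distr[OF prob_space_Psi[OF assms] measurable_censor_Psi[OF assms(2)]])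

definition lik_ratio ::
  "real \<Rightarrow> real \<Rightarrow> real \<Rightarrow> real \<Rightarrow> real \<Rightarrow> real \<Rightarrow> real \<Rightarrow> real \<Rightarrow> real \<times> real option \<Rightarrow> real" where
  "lik_ratio \<mu>1 \<mu>2 v m1 m2 v1 v2 \<gamma> = (\<lambda>(x1, y).
     case y of
       None \<Rightarrow> normal_pdf \<mu>1 v x1 / normal_pdf m1 v1 x1
     | Some x2 \<Rightarrow> normal_pdf \<mu>1 v x1 * normal_pdf \<mu>2 v x2 /
         (normal_pdf m1 v1 x1 * normal_pdf (m2 - \<gamma> * (x1 - m1)) v2 x2))"

lemma measurable_lik_ratio[measurable]:
  "lik_ratio \<mu>1 \<mu>2 v m1 m2 v1 v2 \<gamma> \<in> borel_measurable (borel \<Otimes>\<^sub>M option_borel)"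
proof -
  have [measurable]: "(\<lambda>z. normal_pdf (m2 - \<gamma> * (fst z - m1)) v2 (the (snd z)))
      \<in> borel_measurable (borel \<Otimes>\<^sub>M option_borel)"
    unfolding normal_density_def by measurable
  have "lik_ratio \<mu>1 \<mu>2 v m1 m2 v1 v2 \<gamma> = (\<lambda>z. if snd z = None
      then normal_pdf \<mu>1 v (fst z) / normal_pdf m1 v1 (fst z)
      else normal_pdf \<mu>1 v (fst z) * normal_pdf \<mu>2 v (the (snd z)) /
        (normal_pdf m1 v1 (fst z) * normal_pdf (m2 - \<gamma> * (fst z - m1)) v2 (the (snd z))))"
    by (auto simp: lik_ratio_def fun_eq_iff split: option.split)
  also have "\<dots> \<in> borel_measurable (borel \<Otimes>\<^sub>M option_borel)"
    by measurable
  finally show ?thesis .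
qed

lemma lik_ratio_pos:
  assumes "0 < v" "0 < v1" "0 < v2"
  shows "0 < lik_ratio \<mu>1 \<mu>2 v m1 m2 v1 v2 \<gamma> z"
  using assms by (auto simp: lik_ratio_def normal_density_pos split: option.split prod.split)

lemma nn_integral_normal_law:
  assumes "0 < v" and [measurable]: "f \<in> borel_measurable borel"
  shows "(\<integral>\<^sup>+x. f x \<partial>normal_law m v) = (\<integral>\<^sup>+x. ennreal (normal_pdf m v x) * f x \<partial>lborel)"
  using assms(1) by (simp add: normal_law_def nn_integral_density)

lemma history_eq_density:
  assumes v: "0 < v" "0 < v1" "0 < v2"
  shows "history (Psi \<mu>1 \<mu>2 v v 0) c =
    density (history (Psi m1 m2 v1 v2 \<gamma>) c) (\<lambda>z. ennreal (lik_ratio \<mu>1 \<mu>2 v m1 m2 v1 v2 \<gamma> z))"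
    (is "?P = density ?Q (\<lambda>z. ennreal (?g z))")
proof (rule measure_eqI)
  show "sets ?P = sets (density ?Q (\<lambda>z. ennreal (?g z)))" by simp
  fix A assume "A \<in> sets ?P"
  then have A[measurable]: "A \<in> sets (borel \<Otimes>\<^sub>M option_borel)" by simp
  note [measurable] = measurable_normal_law
  let ?N = "\<lambda>x1. normal_law (m2 - \<gamma> * (x1 - m1)) v2"
  define I where "I x1 = (\<integral>\<^sup>+x2. indicator A (censor c (x1, x2)) \<partial>normal_law \<mu>2 v)" for x1
  define J where "J x1 = (\<integral>\<^sup>+x2. ennreal (?g (censor c (x1, x2))) * indicator A (censor c (x1, x2)) \<partial>?N x1)" for x1
  have [measurable]: "(\<lambda>z. normal_pdf (m2 - \<gamma> * (fst z - m1)) v2 (snd z))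
      \<in> borel_measurable (borel \<Otimes>\<^sub>M borel)"
    unfolding normal_density_def by measurable
  have [measurable]: "I \<in> borel_measurable borel"
    unfolding I_def using v by (subst nn_integral_normal_law) measurable
  have J: "J x1 = (\<integral>\<^sup>+x2. ennreal (normal_pdf (m2 - \<gamma> * (x1 - m1)) v2 x2) *
      (ennreal (?g (censor c (x1, x2))) * indicator A (censor c (x1, x2))) \<partial>lborel)" for x1
    unfolding J_def using v by (subst nn_integral_normal_law) measurable
  have [measurable]: "J \<in> borel_measurable borel"
    unfolding J by measurable
  have IJ: "ennreal (normal_pdf \<mu>1 v x1) * I x1 = ennreal (normal_pdf m1 v1 x1) * J x1" for x1
  proof (cases "x1 > c")
    case True
    have 1: "emeasure (normal_law m u) UNIV = 1" if "u > 0" for m u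
      using prob_space.emeasure_space_1[OF prob_space_normal_law, of u m] that by simp
    have "I x1 = indicator A (x1, None)"
      using True v 1 by (simp add: I_def censor_def)
    moreover have "J x1 = ennreal (normal_pdf \<mu>1 v x1 / normal_pdf m1 v1 x1) * indicator A (x1, None)"
      using True v 1 by (simp add: J_def censor_def lik_ratio_def)
    moreover have "ennreal (normal_pdf m1 v1 x1) * ennreal (normal_pdf \<mu>1 v x1 / normal_pdf m1 v1 x1)
        = ennreal (normal_pdf \<mu>1 v x1)"
      using v normal_density_pos[of "sqrt v1" m1 x1] by (simp add: ennreal_mult[symmetric])
    ultimately show ?thesis by (simp add: mult.assoc[symmetric])
  next
    case False
    have "ennreal (normal_pdf \<mu>1 v x1) * I x1 = (\<integral>\<^sup>+x2. ennreal (normal_pdf \<mu>1 v x1) *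
        (ennreal (normal_pdf \<mu>2 v x2) * indicator A (censor c (x1, x2))) \<partial>lborel)"
      unfolding I_def using v
      by (subst nn_integral_normal_law) (auto simp: nn_integral_cmult)
    also have "\<dots> = (\<integral>\<^sup>+x2. ennreal (normal_pdf m1 v1 x1) * (ennreal (normal_pdf (m2 - \<gamma> * (x1 - m1)) v2 x2) *
        (ennreal (?g (censor c (x1, x2))) * indicator A (censor c (x1, x2)))) \<partial>lborel)"
    proof (rule nn_integral_cong)
      fix x2
      have "0 < normal_pdf m1 v1 x1" "0 < normal_pdf (m2 - \<gamma> * (x1 - m1)) v2 x2"
        using v by (auto intro: normal_density_pos)
      then have "normal_pdf \<mu>1 v x1 * normal_pdf \<mu>2 v x2 =
          normal_pdf m1 v1 x1 * (normal_pdf (m2 - \<gamma> * (x1 - m1)) v2 x2 * ?g (censor c (x1, x2)))"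
        using False by (simp add: censor_def lik_ratio_def)
      moreover have "0 \<le> ?g (censor c (x1, x2))"
        by (rule less_imp_le[OF lik_ratio_pos[OF v]])
      ultimately have "ennreal (normal_pdf \<mu>1 v x1) * ennreal (normal_pdf \<mu>2 v x2) =
          ennreal (normal_pdf m1 v1 x1) * (ennreal (normal_pdf (m2 - \<gamma> * (x1 - m1)) v2 x2) * ennreal (?g (censor c (x1, x2))))"
        by (simp add: ennreal_mult[symmetric])
      then show "ennreal (normal_pdf \<mu>1 v x1) *
            (ennreal (normal_pdf \<mu>2 v x2) * indicator A (censor c (x1, x2))) =
          ennreal (normal_pdf m1 v1 x1) * (ennreal (normal_pdf (m2 - \<gamma> * (x1 - m1)) v2 x2) *
            (ennreal (?g (censor c (x1, x2))) * indicator A (censor c (x1, x2))))"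
        by (simp only: mult.assoc[symmetric])
    qed
    also have "\<dots> = ennreal (normal_pdf m1 v1 x1) * J x1"
      unfolding J by (rule nn_integral_cmult) measurable
    finally show ?thesis .
  qed
  have "emeasure ?P A = (\<integral>\<^sup>+z. indicator A z \<partial>?P)" by simp
  also have "\<dots> = (\<integral>\<^sup>+x1. I x1 \<partial>normal_law \<mu>1 v)"
    unfolding I_def using v by (subst nn_integral_history) auto
  also have "\<dots> = (\<integral>\<^sup>+x1. J x1 \<partial>normal_law m1 v1)"
    using v IJ by (simp add: nn_integral_normal_law)
  also have "\<dots> = (\<integral>\<^sup>+z. ennreal (?g z) * indicator A z \<partial>?Q)"
    unfolding J_def using v by (subst nn_integral_history) auto
  also have "\<dots> = emeasure (density ?Q (\<lambda>z. ennreal (?g z))) A"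
    by (subst emeasure_density) auto
  finally show "emeasure ?P A = emeasure (density ?Q (\<lambda>z. ennreal (?g z))) A" .
qed

lemma AE_normal_law_iff:
  assumes "0 < v"
  shows "(AE x in normal_law m v. P x) \<longleftrightarrow> (AE x in lborel. P x)"
proof -
  have "normal_law m v = density lborel (\<lambda>x. ennreal (normal_pdf m v x))"
    using assms by (simp add: normal_law_def)
  moreover have "(\<lambda>x. ennreal (normal_pdf m v x)) \<in> borel_measurable lborel" by measurable
  ultimately have "(AE x in normal_law m v. P x) \<longleftrightarrow>
      (AE x in lborel. 0 < ennreal (normal_pdf m v x) \<longrightarrow> P x)"
    by (metis AE_density)
  then show ?thesis using assms by (simp add: normal_density_pos)
qed

lemma AE_normal_law_neq:
  assumes "0 < v"
  shows "AE x in normal_law m v. x \<noteq> a"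
  unfolding AE_normal_law_iff[OF assms] by (rule AE_lborel_singleton)

lemma emeasure_normal_law_atMost:
  assumes "0 < v"
  shows "emeasure (normal_law m v) {..c} \<noteq> 0"
proof
  assume "emeasure (normal_law m v) {..c} = 0"
  then have "AE x in normal_law m v. \<not> x \<le> c"
    by (subst AE_iff_measurable[of "{..c}"]) auto
  then have "AE x in lborel. \<not> x \<le> c"
    unfolding AE_normal_law_iff[OF assms] .
  then have "emeasure lborel {..c} = 0"
    by (subst (asm) AE_iff_measurable[of "{..c}"]) auto
  moreover have "emeasure lborel {c - 1..c} \<le> emeasure lborel {..c}"
    by (intro emeasure_mono) auto
  ultimately show False by simp
qed

lemma D_KL_history_degenerate:
  assumes v: "0 < v" "0 \<le> v1" "0 \<le> v2" and 0: "v1 = 0 \<or> v2 = 0"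
  shows "D_KL (history (Psi \<mu>1 \<mu>2 v v 0) c) (history (Psi m1 m2 v1 v2 \<gamma>) c) = \<infinity>"
proof -
  let ?P = "history (Psi \<mu>1 \<mu>2 v v 0) c" and ?Q = "history (Psi m1 m2 v1 v2 \<gamma>) c"
  have one: "emeasure (normal_law m u) UNIV = 1" if "u \<ge> 0" for m u
    using prob_space.emeasure_space_1[OF prob_space_normal_law, of u m] that by simp
  have emP: "emeasure ?P A = (\<integral>\<^sup>+x1. \<integral>\<^sup>+x2. indicator A (censor c (x1, x2)) \<partial>normal_law \<mu>2 v \<partial>normal_law \<mu>1 v)"
    if [measurable]: "A \<in> sets (borel \<Otimes>\<^sub>M option_borel)" for A
    using nn_integral_history[of v "indicator A" \<mu>1 \<mu>2 v 0 c] v by simp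
  have emQ: "emeasure ?Q A = (\<integral>\<^sup>+x1. \<integral>\<^sup>+x2. indicator A (censor c (x1, x2))
      \<partial>normal_law (m2 - \<gamma> * (x1 - m1)) v2 \<partial>normal_law m1 v1)"
    if [measurable]: "A \<in> sets (borel \<Otimes>\<^sub>M option_borel)" for A
    using nn_integral_history[of v2 "indicator A" m1 m2 v1 \<gamma> c] v by simp
  have "\<exists>A \<in> sets (borel \<Otimes>\<^sub>M option_borel). emeasure ?Q A = 0 \<and> emeasure ?P A \<noteq> 0"
    using 0
  proof
    assume v1: "v1 = 0"
    define A :: "(real \<times> real option) set" where "A = {z. fst z \<noteq> m1}"
    have A[measurable]: "A \<in> sets (borel \<Otimes>\<^sub>M option_borel)"
      using measurable_sets[OF measurable_fst, of "- {m1}" borel option_borel]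
      by (auto simp: A_def space_pair_measure vimage_def Compl_eq)
    have ind: "indicator A (censor c (x1, x2)) = (indicator (- {m1}) x1 :: ennreal)" for x1 x2
      by (auto simp: A_def censor_def indicator_def)
    have "emeasure ?Q A = 0"
    proof -
      have "emeasure ?Q A = (\<integral>\<^sup>+x1. indicator (- {m1}) x1 \<partial>normal_law m1 v1)"
        unfolding emQ[OF A] ind using one[OF v(3)] by simp
      then show ?thesis using v1 by (simp add: normal_law_def)
    qed
    moreover have "emeasure ?P A = emeasure (normal_law \<mu>1 v) (- {m1})"
      using v by (simp add: emP ind one)
    moreover have "emeasure (normal_law \<mu>1 v) (- {m1}) = emeasure (normal_law \<mu>1 v) UNIV"
      using AE_normal_law_neq[OF v(1), where m = \<mu>1 and a = m1] by (intro emeasure_eq_AE) auto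
    ultimately show ?thesis using A v one[of v \<mu>1] by (auto intro!: bexI[of _ A])
  next
    assume v2: "v2 = 0"
    define A :: "(real \<times> real option) set"
      where "A = {z. snd z \<noteq> None \<and> the (snd z) \<noteq> m2 - \<gamma> * (fst z - m1)}"
    have "Measurable.pred (borel \<Otimes>\<^sub>M option_borel)
        (\<lambda>z :: real \<times> real option. snd z \<noteq> None \<and> the (snd z) \<noteq> m2 - \<gamma> * (fst z - m1))"
      by measurable
    then have A[measurable]: "A \<in> sets (borel \<Otimes>\<^sub>M option_borel)"
      by (simp add: A_def pred_def space_pair_measure)
    have ind: "indicator A (censor c (x1, x2)) =
        (indicator {..c} x1 * indicator (- {m2 - \<gamma> * (x1 - m1)}) x2 :: ennreal)" for x1 x2
      by (auto simp: A_def censor_def indicator_def)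
    have "emeasure ?Q A = 0"
      unfolding emQ[OF A] ind using v2 by (simp add: nn_integral_cmult normal_law_def[of _ 0])
    moreover have "emeasure ?P A = emeasure (normal_law \<mu>1 v) {..c}"
    proof -
      have "emeasure (normal_law \<mu>2 v) (- {a}) = 1" for a
      proof -
        have "emeasure (normal_law \<mu>2 v) (- {a}) = emeasure (normal_law \<mu>2 v) UNIV"
          using AE_normal_law_neq[OF v(1), where m = \<mu>2 and a = a] by (intro emeasure_eq_AE) auto
        then show ?thesis using v one[of v \<mu>2] by simp
      qed
      then show ?thesis
        using v by (simp add: emP ind nn_integral_cmult)
    qed
    ultimately show ?thesis
      using A emeasure_normal_law_atMost[OF v(1), of \<mu>1 c] by (auto intro!: bexI[of _ A])
  qed
  then have "\<not> absolutely_continuous ?Q ?P"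
    by (auto dest: absolutely_continuousD)
  then show ?thesis by (simp add: D_KL_def)
qed

lemma ln_normal_pdf_ratio:
  assumes "0 < v" "0 < w"
  shows "ln (normal_pdf a v x / normal_pdf b w x) =
    (ln w - ln v) / 2 + (x - b)\<^sup>2 / (2 * w) - (x - a)\<^sup>2 / (2 * v)"
proof -
  have "ln (normal_pdf a u x) = - (ln (2 * pi) + ln u) / 2 - (x - a)\<^sup>2 / (2 * u)" if "0 < u" for a u
    using that by (simp add: normal_density_def ln_mult ln_div ln_sqrt field_simps)
  note ln_pdf = this[OF assms(1), of a] this[OF assms(2), of b]
  have "0 < normal_pdf a v x" "0 < normal_pdf b w x"
    using assms by (auto intro: normal_density_pos)
  then show ?thesis
    by (simp only: ln_div ln_pdf) (simp add: diff_divide_distrib add_divide_distrib)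
qed

lemma integrable_normal_law_square:
  assumes "0 < v"
  shows "integrable (normal_law m v) (\<lambda>x. (x - b)\<^sup>2)"
proof -
  have "integrable lborel (\<lambda>x. normal_pdf m v x * (x - m) ^ k)" for k
    by (rule integrable_normal_moment) (use assms in simp)
  then have k: "integrable (normal_law m v) (\<lambda>x. (x - m) ^ k)" for k
    using assms by (simp add: normal_law_def integrable_real_density)
  have "integrable (normal_law m v) (\<lambda>x. (x - m) ^ 2 + 2 * (m - b) * (x - m) ^ 1 + (m - b)\<^sup>2 * (x - m) ^ 0)"
    by (intro Bochner_Integration.integrable_add integrable_mult_right k)
  also have "(\<lambda>x. (x - m) ^ 2 + 2 * (m - b) * (x - m) ^ 1 + (m - b)\<^sup>2 * (x - m) ^ 0) = (\<lambda>x. (x - b)\<^sup>2)"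
    by (auto simp: power2_eq_square algebra_simps)
  finally show ?thesis .
qed

lemma D_KL_history:
  assumes v: "0 < v" "0 < v1" "0 < v2"
  shows "D_KL (history (Psi \<mu>1 \<mu>2 v v 0) c) (history (Psi m1 m2 v1 v2 \<gamma>) c) = ereal (
    (LINT x1:{c<..}|lborel. normal_pdf \<mu>1 v x1 * ln (normal_pdf \<mu>1 v x1 / normal_pdf m1 v1 x1)) +
    (LINT x1:{..c}|lborel. LINT x2|lborel. normal_pdf \<mu>1 v x1 * normal_pdf \<mu>2 v x2 *
      ln (normal_pdf \<mu>1 v x1 * normal_pdf \<mu>2 v x2 /
        (normal_pdf m1 v1 x1 * normal_pdf (m2 - \<gamma> * (x1 - m1)) v2 x2))))"
proof -
  let ?P = "history (Psi \<mu>1 \<mu>2 v v 0) c" and ?Q = "history (Psi m1 m2 v1 v2 \<gamma>) c"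
  let ?g = "lik_ratio \<mu>1 \<mu>2 v m1 m2 v1 v2 \<gamma>"
  let ?N1 = "normal_law \<mu>1 v" and ?N2 = "normal_law \<mu>2 v"
  interpret Q: prob_space ?Q by (rule prob_space_history) (use v in auto)
  interpret N1: prob_space ?N1 by (rule prob_space_normal_law) (use v in auto)
  interpret N2: prob_space ?N2 by (rule prob_space_normal_law) (use v in auto)
  interpret N: pair_prob_space ?N1 ?N2 ..
  interpret S: pair_prob_space ?N2 ?N1 ..

  have g[measurable]: "?g \<in> borel_measurable (borel \<Otimes>\<^sub>M option_borel)" by simp
  have gQ: "(\<lambda>z. ennreal (?g z)) \<in> borel_measurable ?Q" by measurable
  have dens: "density ?Q (\<lambda>z. ennreal (?g z)) = ?P" by (rule history_eq_density[OF v, symmetric])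
  have ac: "absolutely_continuous ?Q ?P"
    unfolding dens[symmetric] by (rule absolutely_continuousI_density[OF gQ])
  have "AE z in ?Q. ennreal (?g z) = RN_deriv ?Q ?P z"
    by (rule Q.RN_deriv_unique[OF gQ dens])
  then have "AE z in ?P. ennreal (?g z) = RN_deriv ?Q ?P z"
    by (rule absolutely_continuous_AE[OF _ ac, rotated]) simp
  then have ed: "AE z in ?P. entropy_density (exp 1) ?Q ?P z = ln (?g z)"
  proof eventually_elim
    case (elim z)
    have "0 \<le> ?g z" by (rule less_imp_le[OF lik_ratio_pos[OF v]])
    then show ?case by (simp add: entropy_density_def log_ln elim[symmetric])
  qed

  define F where "F z = ln (?g (censor c z))" for z
  have F_meas[measurable]: "F \<in> borel_measurable (borel \<Otimes>\<^sub>M borel)" unfolding F_def by measurable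
  define l1 where "l1 x = ln (normal_pdf \<mu>1 v x / normal_pdf m1 v1 x)" for x
  define l2 where "l2 x y = ln (normal_pdf \<mu>2 v y / normal_pdf (m2 - \<gamma> * (x - m1)) v2 y)" for x y
  have F_gt: "F (x, y) = l1 x" if "x > c" for x y
    using that by (simp add: F_def censor_def lik_ratio_def l1_def)
  have F_le: "F (x, y) = l1 x + l2 x y" if "x \<le> c" for x y
  proof -
    have "0 < normal_pdf \<mu>1 v x" "0 < normal_pdf \<mu>2 v y" "0 < normal_pdf m1 v1 x"
      "0 < normal_pdf (m2 - \<gamma> * (x - m1)) v2 y"
      using v by (auto intro: normal_density_pos)
    then show ?thesis
      using that by (simp add: F_def censor_def lik_ratio_def l1_def l2_def ln_div ln_mult)
  qed

  have int_fst: "integrable (?N1 \<Otimes>\<^sub>M ?N2) (\<lambda>z. (fst z - b)\<^sup>2)" for b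
    using integrable_distr[of fst "?N1 \<Otimes>\<^sub>M ?N2" ?N1 "\<lambda>x. (x - b)\<^sup>2"]
      integrable_normal_law_square[OF v(1), of \<mu>1 b]
    by (simp add: N2.distr_pair_fst)
  have int_snd: "integrable (?N1 \<Otimes>\<^sub>M ?N2) (\<lambda>z. (snd z - b)\<^sup>2)" for b
  proof -
    have "integrable (?N2 \<Otimes>\<^sub>M ?N1) (\<lambda>z. (fst z - b)\<^sup>2)"
      using integrable_distr[of fst "?N2 \<Otimes>\<^sub>M ?N1" ?N2 "\<lambda>x. (x - b)\<^sup>2"]
        integrable_normal_law_square[OF v(1), of \<mu>2 b]
      by (simp add: N1.distr_pair_fst)
    then show ?thesis
      using N.integrable_product_swap_iff[of "\<lambda>z. (snd z - b)\<^sup>2"] by (simp add: case_prod_unfold)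
  qed
  have int_mixed: "integrable (?N1 \<Otimes>\<^sub>M ?N2) (\<lambda>z. (snd z - (m2 - \<gamma> * (fst z - m1)))\<^sup>2)"
  proof (rule Bochner_Integration.integrable_bound)
    show "integrable (?N1 \<Otimes>\<^sub>M ?N2) (\<lambda>z. 2 * (snd z - m2)\<^sup>2 + 2 * \<gamma>\<^sup>2 * (fst z - m1)\<^sup>2)"
      by (intro Bochner_Integration.integrable_add integrable_mult_right int_fst int_snd)
    have "(y - (m2 - \<gamma> * (x - m1)))\<^sup>2 \<le> 2 * (y - m2)\<^sup>2 + 2 * \<gamma>\<^sup>2 * (x - m1)\<^sup>2" for x y
    proof -
      have "2 * (y - m2)\<^sup>2 + 2 * \<gamma>\<^sup>2 * (x - m1)\<^sup>2 - (y - (m2 - \<gamma> * (x - m1)))\<^sup>2 =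
          ((y - m2) - \<gamma> * (x - m1))\<^sup>2"
        by (simp add: power2_eq_square algebra_simps)
      then show ?thesis by (metis diff_ge_0_iff_ge zero_le_power2)
    qed
    then show "AE z in ?N1 \<Otimes>\<^sub>M ?N2. norm ((snd z - (m2 - \<gamma> * (fst z - m1)))\<^sup>2)
        \<le> norm (2 * (snd z - m2)\<^sup>2 + 2 * \<gamma>\<^sup>2 * (fst z - m1)\<^sup>2)"
      by auto
  qed measurable
  have sq1: "integrable (?N1 \<Otimes>\<^sub>M ?N2) (\<lambda>z. l1 (fst z))"
    unfolding l1_def ln_normal_pdf_ratio[OF v(1,2)]
    by (intro Bochner_Integration.integrable_add Bochner_Integration.integrable_diff
        integrable_divide_zero int_fst N.P.integrable_const)
  have sq2: "integrable (?N1 \<Otimes>\<^sub>M ?N2) (\<lambda>z. l2 (fst z) (snd z))"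
    unfolding l2_def ln_normal_pdf_ratio[OF v(1,3)]
    by (intro Bochner_Integration.integrable_add Bochner_Integration.integrable_diff
        integrable_divide_zero int_snd int_mixed N.P.integrable_const)
  have F_int: "integrable (?N1 \<Otimes>\<^sub>M ?N2) F"
  proof (rule Bochner_Integration.integrable_bound)
    show "integrable (?N1 \<Otimes>\<^sub>M ?N2) (\<lambda>z. \<bar>l1 (fst z)\<bar> + \<bar>l2 (fst z) (snd z)\<bar>)"
      by (intro Bochner_Integration.integrable_add integrable_abs sq1 sq2)
    have "\<bar>F z\<bar> \<le> \<bar>l1 (fst z)\<bar> + \<bar>l2 (fst z) (snd z)\<bar>" for z
      by (cases z, cases "fst z > c") (auto simp: F_gt F_le)
    then show "AE z in ?N1 \<Otimes>\<^sub>M ?N2. norm (F z) \<le> norm (\<bar>l1 (fst z)\<bar> + \<bar>l2 (fst z) (snd z)\<bar>)"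
      by auto
  qed measurable

  have PN: "?P = distr (?N1 \<Otimes>\<^sub>M ?N2) (borel \<Otimes>\<^sub>M option_borel) (censor c)"
    using v by (simp add: history_def Psi_indep)
  have cens[measurable]: "censor c \<in> measurable (?N1 \<Otimes>\<^sub>M ?N2) (borel \<Otimes>\<^sub>M option_borel)"
    by measurable
  have ln_g: "(\<lambda>z. ln (?g z)) \<in> borel_measurable (borel \<Otimes>\<^sub>M option_borel)" by measurable
  have edm: "entropy_density (exp 1) ?Q ?P \<in> borel_measurable ?P"
    using measurable_entropy_density[of "exp 1" ?Q ?P]
    by (subst measurable_cong_sets[of ?P ?Q borel borel]) simp_all
  have ln_gP: "(\<lambda>z. ln (?g z)) \<in> borel_measurable ?P" by measurable
  have int_P: "integrable ?P (\<lambda>z. ln (?g z))"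
    unfolding PN integrable_distr_eq[OF cens ln_g] using F_int by (simp add: F_def[abs_def])
  then have int: "integrable ?P (entropy_density (exp 1) ?Q ?P)"
    using integrable_cong_AE[OF edm ln_gP ed] by simp
  have "KL_divergence (exp 1) ?Q ?P = (\<integral>z. ln (?g z) \<partial>?P)"
    unfolding KL_divergence_def by (rule integral_cong_AE[OF edm ln_gP ed])
  also have "\<dots> = (\<integral>z. F z \<partial>(?N1 \<Otimes>\<^sub>M ?N2))"
    unfolding PN integral_distr[OF cens ln_g] by (simp add: F_def[abs_def])
  also have "\<dots> = (\<integral>x. (\<integral>y. F (x, y) \<partial>?N2) \<partial>?N1)"
    by (rule N.integral_fst'[OF F_int, symmetric])
  also have "\<dots> = (\<integral>x. normal_pdf \<mu>1 v x * (\<integral>y. F (x, y) \<partial>?N2) \<partial>lborel)" (is "_ = (\<integral>x. ?G x \<partial>lborel)")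
  proof -
    have "(\<lambda>x. \<integral>y. F (x, y) \<partial>?N2) \<in> borel_measurable borel"
      using N.integrable_fst'[OF F_int] borel_measurable_integrable
        measurable_cong_sets[OF sets_normal_law refl] by blast
    then show ?thesis
      using v by (simp add: normal_law_def[of \<mu>1] integral_real_density)
  qed
  also have "\<dots> = (LINT x:{c<..}|lborel. ?G x) + (LINT x:{..c}|lborel. ?G x)"
  proof -
    have "integrable ?N1 (\<lambda>x. \<integral>y. F (x, y) \<partial>?N2)"
      by (rule N.integrable_fst'[OF F_int])
    moreover have "(\<lambda>x. \<integral>y. F (x, y) \<partial>?N2) \<in> borel_measurable borel"
      using N.integrable_fst'[OF F_int] borel_measurable_integrable
        measurable_cong_sets[OF sets_normal_law refl] by blast
    ultimately have G: "integrable lborel ?G"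
      using v by (simp add: normal_law_def[of \<mu>1] integrable_real_density)
    have "(LINT x:{c<..} \<union> {..c}|lborel. ?G x) = (LINT x:{c<..}|lborel. ?G x) + (LINT x:{..c}|lborel. ?G x)"
      by (rule set_integral_Un)
        (auto simp: set_integrable_def intro!: integrable_mult_indicator[OF _ G, simplified])
    moreover have "{c<..} \<union> {..c} = UNIV" by auto
    ultimately show ?thesis by (simp add: set_lebesgue_integral_def)
  qed
  also have "(LINT x:{c<..}|lborel. ?G x) =
      (LINT x1:{c<..}|lborel. normal_pdf \<mu>1 v x1 * ln (normal_pdf \<mu>1 v x1 / normal_pdf m1 v1 x1))"
    using N2.prob_space by (intro set_lebesgue_integral_cong) (auto simp: F_gt l1_def)
  also have "(LINT x:{..c}|lborel. ?G x) =
      (LINT x1:{..c}|lborel. LINT x2|lborel. normal_pdf \<mu>1 v x1 * normal_pdf \<mu>2 v x2 *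
        ln (normal_pdf \<mu>1 v x1 * normal_pdf \<mu>2 v x2 /
          (normal_pdf m1 v1 x1 * normal_pdf (m2 - \<gamma> * (x1 - m1)) v2 x2)))"
  proof (intro set_lebesgue_integral_cong allI impI)
    fix x assume "x \<in> {..c}"
    then have Fx: "F (x, y) = ln (normal_pdf \<mu>1 v x * normal_pdf \<mu>2 v y /
        (normal_pdf m1 v1 x * normal_pdf (m2 - \<gamma> * (x - m1)) v2 y))" for y
      by (simp add: F_def censor_def lik_ratio_def)
    have "(\<lambda>y. F (x, y)) \<in> borel_measurable borel" by measurable
    then have "(\<integral>y. F (x, y) \<partial>?N2) = (\<integral>y. normal_pdf \<mu>2 v y * F (x, y) \<partial>lborel)"
      using v by (simp add: normal_law_def[of \<mu>2] integral_real_density)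
    then show "?G x = (LINT x2|lborel. normal_pdf \<mu>1 v x * normal_pdf \<mu>2 v x2 *
        ln (normal_pdf \<mu>1 v x * normal_pdf \<mu>2 v x2 /
          (normal_pdf m1 v1 x * normal_pdf (m2 - \<gamma> * (x - m1)) v2 x2)))"
      by (simp add: Fx mult.assoc)
  qed simp
  finally show ?thesis
    using ac int by (simp add: D_KL_def)
qed

end

theory Submission
  imports Defs "HOL-Real_Asymp.Real_Asymp"
begin

text \<open>The divergence splits into that of two normal laws in the first draw, plus
  $P(X_1 \le c)$ times the divergence in the second draw averaged over $X_1 \le c$. Up to constants
  both summands have the form $(\ln w + (a + d^2) / w) / 2$, where $w$ is the subjective variance and
  $d$ a mean error; this is minimal exactly at $w = a$, $d = 0$. In the second summand
  $a = v + \gamma^2 Var[X_1 | X_1 \le c]$.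

  Monotonicity of the conditional variance: put $F_0(c) = P(X_1 \le c)$, $F_1 = \int F_0$ and
  $F_2 = \int F_1$. Then $Var[X_1 | X_1 \le c] = 2 F_2 / F_0 - (F_1 / F_0)^2$, whose derivative is
  $2 f (F_1^2 - F_0 F_2) / F_0^3$ with $f$ the normal density, so what is needed is strict
  log-concavity of $F_2$.\<close>

section \<open>Calculus of the normal density; integrals against the normal law\<close>

lemma has_real_derivative_normal_pdf:
  assumes "0 < v"
  shows "(normal_pdf m v has_real_derivative - ((x - m) / v) * normal_pdf m v x) (at x)"
proof -
  define k where "k = 1 / sqrt (2 * pi * v)"
  have "((\<lambda>x. k * exp (- (x - m)\<^sup>2 / (2 * v))) has_real_derivative
      - ((x - m) / v) * (k * exp (- (x - m)\<^sup>2 / (2 * v)))) (at x)"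
    using assms by (auto intro!: derivative_eq_intros simp: field_simps power2_eq_square)
  moreover have "normal_pdf m v = (\<lambda>x. k * exp (- (x - m)\<^sup>2 / (2 * v)))"
    using assms by (auto simp: normal_density_def fun_eq_iff k_def)
  ultimately show ?thesis by simp
qed

lemma isCont_normal_pdf: "0 < v \<Longrightarrow> isCont (normal_pdf m v) x"
  by (rule DERIV_isCont[OF has_real_derivative_normal_pdf])

lemma normal_pdf_at_bot:
  assumes "0 < v"
  shows "(normal_pdf m v \<longlongrightarrow> 0) at_bot" "((\<lambda>x. (x - m) * normal_pdf m v x) \<longlongrightarrow> 0) at_bot"
proof -
  define k where "k = 1 / sqrt (2 * pi * v)"
  have k: "0 < k" using assms by (simp add: k_def)
  have eq: "normal_pdf m v = (\<lambda>x. k * exp (- (x - m)\<^sup>2 / (2 * v)))"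
    using assms by (auto simp: normal_density_def fun_eq_iff k_def)
  show "(normal_pdf m v \<longlongrightarrow> 0) at_bot" "((\<lambda>x. (x - m) * normal_pdf m v x) \<longlongrightarrow> 0) at_bot"
    unfolding eq using assms k by real_asymp+
qed

lemma integral_normal_law:
  assumes "0 < v" and [measurable]: "g \<in> borel_measurable borel"
  shows "(\<integral>x. g x \<partial>normal_law m v) = (\<integral>x. normal_pdf m v x * g x \<partial>lborel)"
  using assms(1) by (simp add: normal_law_def integral_real_density)

lemma integrable_normal_law:
  assumes "0 < v" and [measurable]: "g \<in> borel_measurable borel"
  shows "integrable (normal_law m v) g \<longleftrightarrow> integrable lborel (\<lambda>x. normal_pdf m v x * g x)"
  using assms(1) by (simp add: normal_law_def integrable_real_density)

lemma set_integral_normal_law: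
  assumes "0 < v" and [measurable]: "g \<in> borel_measurable borel" "A \<in> sets borel"
  shows "(LINT x:A|normal_law m v. g x) = (LINT x:A|lborel. normal_pdf m v x * g x)"
  unfolding set_lebesgue_integral_def using assms(1)
  by (subst integral_normal_law) (auto intro!: Bochner_Integration.integral_cong)

lemma measure_normal_law_atMost_pos: "0 < v \<Longrightarrow> 0 < measure (normal_law m v) {..c}"
  using emeasure_normal_law_atMost[of v m c] finite_measure.emeasure_eq_measure[of "normal_law m v" "{..c}"]
  by (simp add: prob_space_normal_law prob_space.finite_measure zero_less_measure_iff)

section \<open>Distribution function and partial moments on a lower ray\<close>

lemma set_integral_atMost_FTC:
  fixes G g :: "real \<Rightarrow> real"
  assumes "\<And>x. (G has_real_derivative g x) (at x)" and "\<And>x. isCont g x"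
    and "integrable lborel g" and "(G \<longlongrightarrow> L) at_bot"
  shows "(LINT x:{..c}|lborel. g x) = G c - L"
proof -
  have "(LBINT x=-\<infinity>..ereal c. g x) = G c - L"
  proof (rule interval_integral_FTC_integrable)
    show "set_integrable lborel (einterval (- \<infinity>) (ereal c)) g"
      unfolding set_integrable_def by (rule integrable_mult_indicator) (use assms(3) in auto)
    show "((G \<circ> real_of_ereal) \<longlongrightarrow> L) (at_right (- \<infinity>))"
      using assms(4) by (simp add: ereal_tendsto_simps)
    have "(G \<longlongrightarrow> G c) (at_left c)"
      using DERIV_isCont[OF assms(1)] by (simp add: isCont_def filterlim_at_split)
    then show "((G \<circ> real_of_ereal) \<longlongrightarrow> G c) (at_left (ereal c))"
      by (simp add: ereal_tendsto_simps)
    show "(G has_vector_derivative g x) (at x)" for x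
      using assms(1) by (simp add: has_real_derivative_iff_has_vector_derivative)
  qed (use assms(2) in auto)
  then have "(LINT x:{..<c}|lborel. g x) = G c - L"
    by (simp add: interval_lebesgue_integral_def)
  \<comment> \<open>The interval integral runs over the open ray; adding the endpoint changes the
    integrand on a null set only.\<close>
  moreover have "(LINT x:{..<c}|lborel. g x) = (LINT x:{..c}|lborel. g x)"
    unfolding set_lebesgue_integral_def
  proof (rule integral_cong_AE)
    show "AE x in lborel. indicator {..<c} x *\<^sub>R g x = indicator {..c} x *\<^sub>R g x"
      using AE_lborel_singleton[of c] by eventually_elim (auto simp: indicator_def)
  qed (use assms(3) in auto)
  ultimately show ?thesis by simp
qed

text \<open>Near \<open>c\<close> the distribution function is a constant plus the integral of the
  density over a compact interval starting at \<open>c - 1\<close>. The density is continuous, so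
  the fundamental theorem for compact intervals applies.\<close>

lemma has_real_derivative_measure_normal_law_atMost:
  assumes "0 < v"
  shows "((\<lambda>c. measure (normal_law m v) {..c}) has_real_derivative normal_pdf m v c) (at c)"
proof -
  let ?F = "\<lambda>c. measure (normal_law m v) {..c}" and ?f = "normal_pdf m v"
  interpret prob_space "normal_law m v" by (rule prob_space_normal_law) (use assms in simp)
  have cont: "continuous_on A ?f" for A
    by (meson assms continuous_at_imp_continuous_on isCont_normal_pdf)
  have int: "set_integrable lborel A ?f" if "A \<in> sets borel" for A
    unfolding set_integrable_def by (rule integrable_mult_indicator) (use assms that in auto)
  have F: "?F u = ?F (c - 1) + integral {c - 1..u} ?f" if "u \<in> {c - 1..c + 1}" for u
  proof -
    have "?F u = ?F (c - 1) + measure (normal_law m v) {c - 1<..u}"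
      using that by (subst finite_measure_Union[symmetric]) (auto intro!: arg_cong[where f = prob])
    also have "measure (normal_law m v) {c - 1<..u} = (LINT x:{c - 1<..u}|lborel. ?f x)"
      using set_integral_normal_law[OF assms, of "\<lambda>_. 1" "{c - 1<..u}" m]
      by (simp add: set_lebesgue_integral_def)
    also have "\<dots> = integral {c - 1<..u} ?f"
      by (rule set_borel_integral_eq_integral(2)[OF int]) simp
    also have "\<dots> = integral {c - 1..u} ?f"
      by (rule integral_subset_negligible) (auto intro: negligible_subset[of "{c - 1}"])
    finally show ?thesis .
  qed
  have "((\<lambda>u. ?F (c - 1) + integral {c - 1..u} ?f) has_real_derivative 0 + ?f c) (at c within {c - 1..c + 1})"
    by (intro DERIV_add DERIV_const integral_has_real_derivative cont) simp
  then have "(?F has_real_derivative 0 + ?f c) (at c within {c - 1..c + 1})"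
    by (rule has_field_derivative_transform_within[OF _ zero_less_one]) (simp, rule F[symmetric])
  \<comment> \<open>\<open>c\<close> is interior to the interval, so the derivative within it is the
    two-sided one.\<close>
  then show ?thesis
    by (simp add: at_within_Icc_at)
qed

lemma measure_normal_law_at_bot:
  assumes "0 < v"
  shows "((\<lambda>c. measure (normal_law m v) {..c}) \<longlongrightarrow> 0) at_bot"
proof -
  interpret real_distribution "normal_law m v"
    using assms by (auto simp: real_distribution_def real_distribution_axioms_def prob_space_normal_law)
  show ?thesis using cdf_lim_at_bot by (simp add: cdf_def[abs_def])
qed

lemma integrable_normal_law_moments:
  assumes "0 < v"
  shows "integrable (normal_law m v) (\<lambda>x. x)" "integrable (normal_law m v) (\<lambda>x. x\<^sup>2)"
  using assms integrable_normal_law_square[OF assms, of m 0] integrable_normal_moment_nz_1[of "sqrt v" m]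
  by (auto simp: integrable_normal_law)

text \<open>Since f' = -((x - m) / v) f, the function -v f is an antiderivative of (x - m) f, and -v
  (x - m) f is one of (x - m)^2 f - v f. Both vanish at minus infinity; in the second case the
  subtracted v f contributes \<open>v\<close> times the probability of the ray.\<close>

lemma set_integral_atMost_normal_law:
  assumes "0 < v"
  shows "(LINT x:{..c}|normal_law m v. x - m) = - v * normal_pdf m v c"
    and "(LINT x:{..c}|normal_law m v. (x - m)\<^sup>2) =
      v * measure (normal_law m v) {..c} - v * (c - m) * normal_pdf m v c"
proof -
  let ?f = "normal_pdf m v"
  note [derivative_intros] = DERIV_chain2[OF has_real_derivative_normal_pdf[OF assms]]
  have sq: "0 < sqrt v" using assms by simp
  note int = integrable_normal_moment[OF sq, of m]
  have "(LINT x:{..c}|lborel. ?f x * (x - m)) = - v * ?f c - 0"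
  proof (rule set_integral_atMost_FTC)
    show "((\<lambda>x. - v * ?f x) has_real_derivative ?f x * (x - m)) (at x)" for x
      using assms by (auto intro!: derivative_eq_intros)
    show "((\<lambda>x. - v * ?f x) \<longlongrightarrow> 0) at_bot"
      using tendsto_mult[OF tendsto_const[of "- v"] normal_pdf_at_bot(1)[OF assms, of m]] by simp
  qed (use int[of 1] isCont_normal_pdf[OF assms] in auto)
  then show "(LINT x:{..c}|normal_law m v. x - m) = - v * ?f c"
    using assms by (subst set_integral_normal_law) auto
  have "(LINT x:{..c}|lborel. ?f x * (x - m)\<^sup>2 - v * ?f x) = - v * ((c - m) * ?f c) - 0"
  proof (rule set_integral_atMost_FTC)
    show "((\<lambda>x. - v * ((x - m) * ?f x)) has_real_derivative ?f x * (x - m)\<^sup>2 - v * ?f x) (at x)" for x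
    proof -
      have "((\<lambda>x. - v * ((x - m) * ?f x)) has_real_derivative
          - v * ((1 - 0) * ?f x + (- ((x - m) / v) * ?f x) * (x - m))) (at x)"
        by (intro DERIV_cmult DERIV_mult DERIV_diff DERIV_ident DERIV_const
            has_real_derivative_normal_pdf assms)
      \<comment> \<open>With this cancellation as a premise, the identity of derivatives is purely
        polynomial.\<close>
      moreover have "v * ((x - m) / v) = x - m" using assms by simp
      then have "- v * ((1 - 0) * ?f x + (- ((x - m) / v) * ?f x) * (x - m)) = ?f x * (x - m)\<^sup>2 - v * ?f x"
        by algebra
      ultimately show ?thesis by simp
    qed
    show "((\<lambda>x. - v * ((x - m) * ?f x)) \<longlongrightarrow> 0) at_bot"
      using tendsto_mult[OF tendsto_const[of "- v"] normal_pdf_at_bot(2)[OF assms, of m]] by simp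
    show "integrable lborel (\<lambda>x. ?f x * (x - m)\<^sup>2 - v * ?f x)"
      using int[of 2] int[of 0] by simp
  qed (use isCont_normal_pdf[OF assms] in auto)
  moreover have "(LINT x:{..c}|lborel. ?f x * (x - m)\<^sup>2 - v * ?f x) =
      (LINT x:{..c}|lborel. ?f x * (x - m)\<^sup>2) - (LINT x:{..c}|lborel. v * ?f x)"
  proof (rule set_integral_diff)
    show "set_integrable lborel {..c} (\<lambda>x. ?f x * (x - m)\<^sup>2)"
      unfolding set_integrable_def by (rule integrable_mult_indicator) (use int[of 2] in auto)
    show "set_integrable lborel {..c} (\<lambda>x. v * ?f x)"
      unfolding set_integrable_def by (rule integrable_mult_indicator) (use int[of 0] in auto)
  qed
  moreover have "(LINT x:{..c}|lborel. v * ?f x) = v * measure (normal_law m v) {..c}"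
    using set_integral_normal_law[OF assms, of "\<lambda>_. 1" "{..c}" m]
    by (simp add: set_lebesgue_integral_def)
  moreover have "(LINT x:{..c}|normal_law m v. (x - m)\<^sup>2) = (LINT x:{..c}|lborel. ?f x * (x - m)\<^sup>2)"
    using assms by (subst set_integral_normal_law) auto
  ultimately show "(LINT x:{..c}|normal_law m v. (x - m)\<^sup>2) =
      v * measure (normal_law m v) {..c} - v * (c - m) * ?f c"
    by (simp add: algebra_simps)
qed

text \<open>A nonnegative integrand with zero integral vanishes almost everywhere, which would make
  the ray null. Strict positivity is asked for below \<open>c\<close> only, because the integrands
  of interest, \<open>c - x\<close> and its square, vanish at \<open>c\<close>, a null
  point.\<close>

lemma set_integral_atMost_normal_law_pos:
  fixes g :: "real \<Rightarrow> real"
  assumes "0 < v" and "integrable (normal_law m v) g" and "\<And>x. x < c \<Longrightarrow> 0 < g x" and "0 \<le> g c"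
  shows "0 < (LINT x:{..c}|normal_law m v. g x)"
proof -
  let ?N = "normal_law m v" and ?g = "\<lambda>x. indicator {..c} x *\<^sub>R g x"
  have int: "integrable ?N ?g"
    by (rule integrable_mult_indicator[OF _ assms(2)]) simp
  have nonneg: "0 \<le> ?g x" for x
    using assms(3)[of x] assms(4) by (cases "x = c") (auto simp: indicator_def)
  have "integral\<^sup>L ?N ?g \<noteq> 0"
  proof
    assume "integral\<^sup>L ?N ?g = 0"
    then have "AE x in ?N. ?g x = 0"
      using integral_nonneg_eq_0_iff_AE[OF int] nonneg by simp
    with AE_normal_law_neq[OF assms(1), where m = m and a = c] have "AE x in ?N. x \<notin> {..c}"
    proof eventually_elim
      case (elim x)
      then show ?case using assms(3)[of x] by (auto simp: indicator_def split: if_splits)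
    qed
    then have "emeasure ?N {..c} = 0"
      by (subst (asm) AE_iff_measurable[of "{..c}"]) auto
    then show False using emeasure_normal_law_atMost[OF assms(1)] by blast
  qed
  moreover have "0 \<le> integral\<^sup>L ?N ?g" using nonneg by (rule Bochner_Integration.integral_nonneg)
  ultimately show ?thesis by (simp add: set_lebesgue_integral_def)
qed

section \<open>Conditioning on an event; truncated mean and variance\<close>

lemma (in finite_measure) density_uniform_measure:
  assumes "emeasure M A \<noteq> 0"
  shows "uniform_measure M A = density M (\<lambda>x. ennreal (indicator A x / measure M A))"
proof -
  have "0 < measure M A"
    using assms by (simp add: emeasure_eq_measure zero_less_measure_iff)
  \<comment> \<open>Turns the extended quotient into a real weight, so that integrals under
    conditioning become weighted real integrals.\<close>
  then have "indicator A x / emeasure M A = ennreal (indicator A x / measure M A)" for x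
    by (auto simp: emeasure_eq_measure divide_ennreal[symmetric] indicator_def)
  then show ?thesis by (simp add: uniform_measure_def)
qed

lemma (in finite_measure) integral_uniform_measure:
  fixes g :: "'a \<Rightarrow> real"
  assumes "emeasure M A \<noteq> 0" "A \<in> sets M" "g \<in> borel_measurable M"
  shows "(\<integral>x. g x \<partial>uniform_measure M A) = (LINT x:A|M. g x) / measure M A"
proof -
  have "(\<integral>x. g x \<partial>uniform_measure M A) = (\<integral>x. indicator A x / measure M A * g x \<partial>M)"
    unfolding density_uniform_measure[OF assms(1)] using assms by (subst integral_real_density) auto
  also have "\<dots> = (\<integral>x. indicator A x * g x / measure M A \<partial>M)"
    by simp
  also have "\<dots> = (LINT x:A|M. g x) / measure M A"
    by (simp only: integral_divide_zero set_lebesgue_integral_def real_scaleR_def)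
  finally show ?thesis .
qed

lemma (in finite_measure) integrable_uniform_measure:
  fixes g :: "'a \<Rightarrow> real"
  assumes "emeasure M A \<noteq> 0" and [measurable]: "A \<in> sets M" and "integrable M g"
  shows "integrable (uniform_measure M A) g"
proof -
  have [measurable]: "g \<in> borel_measurable M" using assms by simp
  have "integrable M (\<lambda>x. indicator A x *\<^sub>R g x / measure M A)"
    by (intro integrable_divide_zero integrable_mult_indicator assms)
  then show ?thesis
    unfolding density_uniform_measure[OF assms(1)] by (subst integrable_real_density) auto
qed

text \<open>Bias-variance decomposition: the mean square deviation is one quadratic polynomial in
  the centre, compared at \<open>b\<close> and at the mean.\<close>

lemma (in prob_space) integral_square_deviation:
  fixes g :: "'a \<Rightarrow> real"
  assumes "integrable M g" "integrable M (\<lambda>x. (g x)\<^sup>2)"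
  shows "(\<integral>x. (g x - b)\<^sup>2 \<partial>M) = (\<integral>x. (g x - expectation g)\<^sup>2 \<partial>M) + (expectation g - b)\<^sup>2"
proof -
  have *: "(\<integral>x. (g x - a)\<^sup>2 \<partial>M) = (\<integral>x. (g x)\<^sup>2 \<partial>M) - 2 * a * expectation g + a\<^sup>2" for a
  proof -
    have "(\<integral>x. (g x - a)\<^sup>2 \<partial>M) = (\<integral>x. (g x)\<^sup>2 - 2 * a * g x + a\<^sup>2 \<partial>M)"
      by (intro Bochner_Integration.integral_cong refl) (simp add: power2_eq_square algebra_simps)
    also have "\<dots> = (\<integral>x. (g x)\<^sup>2 \<partial>M) - 2 * a * expectation g + a\<^sup>2"
      using assms by (simp add: prob_space)
    finally show ?thesis .
  qed
  show ?thesis unfolding *[of b] *[of "expectation g"] by (simp add: power2_eq_square algebra_simps)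
qed

text \<open>The partial first moment divided by the mass of the ray; the shift is \<open>v\<close>
  times the reversed hazard rate, density over distribution function.\<close>

lemma cond_mean_normal_law_atMost:
  assumes "0 < v"
  shows "cond_mean (normal_law m v) {..c} = m - v * normal_pdf m v c / measure (normal_law m v) {..c}"
proof -
  let ?N = "normal_law m v" and ?T = "uniform_measure (normal_law m v) {..c}"
  interpret N: prob_space ?N by (rule prob_space_normal_law) (use assms in simp)
  note ne = emeasure_normal_law_atMost[OF assms, of m c]
  interpret T: prob_space ?T by (rule prob_space_uniform_measure) (use ne in auto)
  have "(\<integral>x. x - m \<partial>?T) = - v * normal_pdf m v c / measure ?N {..c}"
    using ne set_integral_atMost_normal_law(1)[OF assms] by (subst N.integral_uniform_measure) auto
  moreover have "(\<integral>x. x - m \<partial>?T) = (\<integral>x. x \<partial>?T) - m"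
    using N.integrable_uniform_measure[OF ne _ integrable_normal_law_moments(1)[OF assms]] T.prob_space
    by simp
  ultimately show ?thesis by (simp add: cond_mean_def)
qed

text \<open>The partial second moment gives the conditional mean square about \<open>m\<close>; by
  the bias-variance decomposition the squared shift of the conditional mean is then
  subtracted.\<close>

lemma cond_var_normal_law_atMost:
  assumes "0 < v"
  shows "cond_var (normal_law m v) {..c} = v - v * (c - m) * (normal_pdf m v c / measure (normal_law m v) {..c})
    - (v * (normal_pdf m v c / measure (normal_law m v) {..c}))\<^sup>2"
proof -
  let ?N = "normal_law m v" and ?T = "uniform_measure (normal_law m v) {..c}"
  interpret N: prob_space ?N by (rule prob_space_normal_law) (use assms in simp)
  note ne = emeasure_normal_law_atMost[OF assms, of m c]
  interpret T: prob_space ?T by (rule prob_space_uniform_measure) (use ne in auto)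
  have "(\<integral>x. (x - m)\<^sup>2 \<partial>?T) = (v * measure ?N {..c} - v * (c - m) * normal_pdf m v c) / measure ?N {..c}"
    using ne set_integral_atMost_normal_law(2)[OF assms] by (subst N.integral_uniform_measure) auto
  also have "\<dots> = v - v * (c - m) * (normal_pdf m v c / measure ?N {..c})"
    using measure_normal_law_atMost_pos[OF assms, of m c] by (simp add: field_simps)
  finally have "(\<integral>x. (x - m)\<^sup>2 \<partial>?T) = v - v * (c - m) * (normal_pdf m v c / measure ?N {..c})" .
  moreover have "(\<integral>x. (x - m)\<^sup>2 \<partial>?T) = cond_var ?N {..c} + (cond_mean ?N {..c} - m)\<^sup>2"
    unfolding cond_var_def cond_mean_def
    by (intro T.integral_square_deviation N.integrable_uniform_measure[OF ne]
        integrable_normal_law_moments[OF assms]) simp_all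
  ultimately show ?thesis by (simp add: cond_mean_normal_law_atMost[OF assms])
qed

section \<open>Monotonicity of the truncated variance\<close>

text \<open>Both $F_1^2 - F_0 F_2$ and $W = F_1 F_0 / f - F_2$ vanish at $-\infty$, and
  $(F_1^2 - F_0 F_2)' = f W$, $W' = 2 F_0 F_2 / (v f)$. The limits follow from $F_1 \le v f$ and
  $F_2 \le v F_0$ on the left of the mean; $F_1, F_2 > 0$ since they are the partial moments
  $E[(c - X_1)^+]$ and $E[((c - X_1)^+)^2] / 2$.\<close>

lemma normal_law_log_concavity:
  fixes m v c :: real
  defines "f \<equiv> normal_pdf m v" and "F0 \<equiv> \<lambda>c. measure (normal_law m v) {..c}"
  defines "F1 \<equiv> \<lambda>c. (c - m) * F0 c + v * f c"
  defines "F2 \<equiv> \<lambda>c. ((c - m) * F1 c + v * F0 c) / 2"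
  assumes v: "0 < v"
  shows "F0 c * F2 c < (F1 c)\<^sup>2"
proof -
  let ?N = "normal_law m v"
  interpret N: prob_space ?N by (rule prob_space_normal_law) (use v in simp)
  have f: "0 < f c" and F0: "0 < F0 c" for c
    using v measure_normal_law_atMost_pos[OF v] by (auto simp: f_def F0_def normal_density_pos)
  note int = integrable_normal_law_moments[OF v, of m]
  have int': "set_integrable ?N {..c} h" if "integrable ?N h" for c and h :: "real \<Rightarrow> real"
    unfolding set_integrable_def by (rule integrable_mult_indicator[OF _ that]) simp
  have const: "(LINT x:{..c}|?N. a) = a * F0 c" for a c
    by (simp add: set_lebesgue_integral_def F0_def)
  have lin: "(LINT x:{..c}|?N. c - x) = F1 c" for c
  proof -
    have "(LINT x:{..c}|?N. c - x) = (LINT x:{..c}|?N. (c - m) - (x - m))" by simp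
    also have "\<dots> = (LINT x:{..c}|?N. c - m) - (LINT x:{..c}|?N. x - m)"
      by (intro set_integral_diff int') (use int in auto)
    finally show ?thesis
      by (simp add: const set_integral_atMost_normal_law(1)[OF v] F1_def f_def)
  qed
  have F1: "0 < F1 c" for c
    unfolding lin[symmetric] by (intro set_integral_atMost_normal_law_pos v) (use int in auto)
  have F2: "0 < F2 c" for c
  proof -
    \<comment> \<open>The square is split so that only partial moments with a known closed form
      occur.\<close>
    have "(LINT x:{..c}|?N. (c - x)\<^sup>2) = (LINT x:{..c}|?N. (x - m)\<^sup>2 + (c - m) * ((c - x) - (x - m)))"
      by (intro set_lebesgue_integral_cong) (auto simp: power2_eq_square algebra_simps)
    also have "\<dots> = (LINT x:{..c}|?N. (x - m)\<^sup>2) + (c - m) * ((LINT x:{..c}|?N. c - x) - (LINT x:{..c}|?N. x - m))"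
      using int integrable_normal_law_square[OF v, of m m]
      by (subst set_integral_add(2)) (auto intro!: int' simp: set_integral_diff(2)[OF int' int'])
    also have "\<dots> = 2 * F2 c"
      by (simp add: lin set_integral_atMost_normal_law[OF v] F0_def f_def)
        (simp add: F2_def F1_def F0_def f_def algebra_simps power2_eq_square)
    finally have "F2 c = (LINT x:{..c}|?N. (c - x)\<^sup>2) / 2" by simp
    moreover have "0 < (LINT x:{..c}|?N. (c - x)\<^sup>2)"
      using integrable_normal_law_square[OF v, of m c]
      by (intro set_integral_atMost_normal_law_pos v) (auto simp: power2_commute)
    ultimately show ?thesis by simp
  qed
  have df: "(f has_real_derivative - ((c - m) / v) * f c) (at c)" for c
    unfolding f_def by (rule has_real_derivative_normal_pdf[OF v])
  have dF0: "(F0 has_real_derivative f c) (at c)" for c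
    unfolding f_def F0_def by (rule has_real_derivative_measure_normal_law_atMost[OF v])
  \<comment> \<open>The closed forms are successive antiderivatives: the derivative of
    \<open>v * f\<close> cancels \<open>(c - m) * f\<close>, and by the definition of
    \<open>F1\<close> the derivative of \<open>F2\<close> is
    \<open>(F1 c + F1 c) / 2\<close>.\<close>
  have dF1: "(F1 has_real_derivative F0 c) (at c)" for c
    unfolding F1_def
    by (rule derivative_eq_intros df dF0 refl)+ (use v in simp)
  have dF2: "(F2 has_real_derivative F1 c) (at c)" for c
    unfolding F2_def
    by (rule derivative_eq_intros dF1 dF0 refl)+ (simp_all add: F1_def field_simps)
  have lim_f: "(f \<longlongrightarrow> 0) at_bot" and lim_F0: "(F0 \<longlongrightarrow> 0) at_bot"
    unfolding f_def F0_def using normal_pdf_at_bot(1)[OF v] measure_normal_law_at_bot[OF v] by auto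
  have F1_le: "F1 c \<le> v * f c" and F2_le: "F2 c \<le> v * F0 c" if "c \<le> m" for c
  proof -
    show "F1 c \<le> v * f c"
      using that F0[of c] by (simp add: F1_def mult_nonpos_nonneg)
    have "(c - m) * F1 c \<le> 0" using that F1[of c] by (simp add: mult_nonpos_nonneg)
    moreover have "0 < v * F0 c" using v F0 by simp
    ultimately show "F2 c \<le> v * F0 c" by (simp add: F2_def)
  qed
  have lim_F1: "(F1 \<longlongrightarrow> 0) at_bot"
  proof (rule tendsto_sandwich[OF _ _ tendsto_const])
    show "((\<lambda>c. v * f c) \<longlongrightarrow> 0) at_bot" using tendsto_mult_right_zero[OF lim_f] .
  qed (use less_imp_le[OF F1] F1_le in \<open>auto intro!: eventually_at_bot_linorderI[of m]\<close>)
  have lim_F2: "(F2 \<longlongrightarrow> 0) at_bot"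
  proof (rule tendsto_sandwich[OF _ _ tendsto_const])
    show "((\<lambda>c. v * F0 c) \<longlongrightarrow> 0) at_bot" using tendsto_mult_right_zero[OF lim_F0] .
  qed (use less_imp_le[OF F2] F2_le in \<open>auto intro!: eventually_at_bot_linorderI[of m]\<close>)
  define W where "W c = F1 c * F0 c / f c - F2 c" for c
  have W: "0 < W b" for b
  proof (rule DERIV_pos_imp_increasing_at_bot[where f = W])
    fix c
    let ?d = "((F0 c * F0 c + f c * F1 c) * f c - F1 c * F0 c * (- ((c - m) / v) * f c)) / (f c * f c) - F1 c"
    have "(W has_real_derivative ?d) (at c)"
      unfolding W_def
      by (intro DERIV_diff DERIV_divide DERIV_mult dF1 dF0 df dF2) (use f[of c] in simp)
    \<comment> \<open>The two terms \<open>F1 c\<close> cancel, and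
      \<open>(c - m) * F1 c + v * F0 c\<close> is \<open>2 * F2 c\<close>.\<close>
    moreover have "?d = 2 * F0 c * F2 c / (v * f c)"
      using f[of c] v by (simp add: F2_def field_simps)
    moreover have "0 < 2 * F0 c * F2 c / (v * f c)" using v f F0 F2 by simp
    ultimately show "\<exists>y. (W has_real_derivative y) (at c) \<and> 0 < y" by metis
  next
    \<comment> \<open>The vanishing denominator is harmless: left of the mean
      \<open>F1 c \<le> v * f c\<close> bounds the quotient by \<open>v * F0 c\<close>.\<close>
    have "((\<lambda>c. F1 c * F0 c / f c) \<longlongrightarrow> 0) at_bot"
    proof (rule tendsto_sandwich[OF _ _ tendsto_const])
      show "((\<lambda>c. v * F0 c) \<longlongrightarrow> 0) at_bot" using tendsto_mult_right_zero[OF lim_F0] .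
      have "F1 c * F0 c / f c \<le> v * F0 c" if "c \<le> m" for c
        using mult_right_mono[OF F1_le[OF that], of "F0 c"] F0[of c] f[of c] by (simp add: field_simps)
      then show "\<forall>\<^sub>F c in at_bot. F1 c * F0 c / f c \<le> v * F0 c"
        by (auto intro: eventually_at_bot_linorderI[of m])
      show "\<forall>\<^sub>F c in at_bot. 0 \<le> F1 c * F0 c / f c"
        using F1 F0 f by (auto intro!: always_eventually less_imp_le)
    qed
    from tendsto_diff[OF this lim_F2] show "(W \<longlongrightarrow> 0) at_bot" by (simp add: W_def[abs_def])
  qed
  have "0 < (F1 c)\<^sup>2 - F0 c * F2 c"
  proof (rule DERIV_pos_imp_increasing_at_bot[where f = "\<lambda>c. (F1 c)\<^sup>2 - F0 c * F2 c"])
    fix c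
    have "((\<lambda>c. (F1 c)\<^sup>2 - F0 c * F2 c) has_real_derivative f c * W c) (at c)"
      by (rule derivative_eq_intros dF1 dF0 dF2 refl)+
        (use f[of c] in \<open>simp add: W_def field_simps\<close>)
    then show "\<exists>y. ((\<lambda>c. (F1 c)\<^sup>2 - F0 c * F2 c) has_real_derivative y) (at c) \<and> 0 < y"
      using f W by (auto intro!: exI[of _ "f c * W c"])
  next
    show "((\<lambda>c. (F1 c)\<^sup>2 - F0 c * F2 c) \<longlongrightarrow> 0) at_bot"
      using tendsto_diff[OF tendsto_power[OF lim_F1, of 2] tendsto_mult[OF lim_F0 lim_F2]] by simp
  qed
  then show ?thesis by simp
qed

text \<open>The variance is a polynomial in \<open>c\<close> and the reversed hazard rate h = f /
  F0, which satisfies the Riccati equation h' = -((c - m) / v) h - h^2. Hence its derivative is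
  again a polynomial in \<open>c\<close> and h, and it is a positive multiple of the log-concavity
  gap.\<close>

lemma strict_mono_cond_var_normal_law_atMost:
  assumes v: "0 < v"
  shows "strict_mono (\<lambda>c. cond_var (normal_law m v) {..c})"
proof -
  define f F0 where "f = normal_pdf m v" and "F0 = (\<lambda>c. measure (normal_law m v) {..c})"
  define F1 where "F1 c = (c - m) * F0 c + v * f c" for c
  define F2 where "F2 c = ((c - m) * F1 c + v * F0 c) / 2" for c
  have f: "0 < f c" and F0: "0 < F0 c" for c
    using v measure_normal_law_atMost_pos[OF v] by (auto simp: f_def F0_def normal_density_pos)
  have K: "F0 c * F2 c < (F1 c)\<^sup>2" for c
    using normal_law_log_concavity[OF v, of m c]
    unfolding F0_def f_def F1_def[abs_def] F2_def[abs_def] by simp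
  have V: "(\<lambda>c. cond_var (normal_law m v) {..c}) = (\<lambda>c. v - v * (c - m) * (f c / F0 c) - (v * (f c / F0 c))\<^sup>2)"
    unfolding cond_var_normal_law_atMost[OF v] f_def F0_def ..
  show ?thesis
  proof (rule strict_monoI)
    fix a b :: real
    assume "a < b"
    then show "cond_var (normal_law m v) {..a} < cond_var (normal_law m v) {..b}"
    proof (rule DERIV_pos_imp_increasing[where f = "\<lambda>c. cond_var (normal_law m v) {..c}"])
      fix c
      define H where "H = (\<lambda>c. f c / F0 c)"
      define h where "h = H c"
      have H: "f c / F0 c = H c" for c by (simp add: H_def)
      have df: "(f has_real_derivative - ((c - m) / v) * f c) (at c)"
        unfolding f_def by (rule has_real_derivative_normal_pdf[OF v])
      have dF0: "(F0 has_real_derivative f c) (at c)"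
        unfolding f_def F0_def by (rule has_real_derivative_measure_normal_law_atMost[OF v])
      have "((\<lambda>c. f c / F0 c) has_real_derivative (- ((c - m) / v) * f c * F0 c - f c * f c) / (F0 c * F0 c)) (at c)"
        by (intro DERIV_divide df dF0) (use F0[of c] in simp)
      moreover have "(- ((c - m) / v) * f c * F0 c - f c * f c) / (F0 c * F0 c) = - ((c - m) / v) * h - h\<^sup>2"
        using F0[of c] v by (simp add: h_def H_def field_simps power2_eq_square)
      ultimately have dh: "(H has_real_derivative - ((c - m) / v) * h - h\<^sup>2) (at c)"
        by (simp add: H_def)
      let ?d = "- v * h - v * (c - m) * (- ((c - m) / v) * h - h\<^sup>2) - 2 * v * v * h * (- ((c - m) / v) * h - h\<^sup>2)"
      have "((\<lambda>c. cond_var (normal_law m v) {..c}) has_real_derivative ?d) (at c)"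
        unfolding V H
        by (rule derivative_eq_intros dh refl)+ (simp add: h_def algebra_simps)
      \<comment> \<open>After division by powers of \<open>F0 c\<close>, the gap too is a polynomial
        in \<open>x\<close> and \<open>h\<close>, because
        \<open>F1 c / F0 c = x + v * h\<close>.\<close>
      moreover have "?d = 2 * h * (((F1 c)\<^sup>2 - F0 c * F2 c) / (F0 c)\<^sup>2)"
      proof -
        define x where "x = c - m"
        have "F1 c / F0 c = x + v * h"
          using F0[of c] by (simp add: F1_def h_def H_def x_def field_simps)
        moreover have "F2 c / F0 c = (x * (x + v * h) + v) / 2"
          using F0[of c] by (simp add: F2_def F1_def h_def H_def x_def field_simps)
        moreover have "((F1 c)\<^sup>2 - F0 c * F2 c) / (F0 c)\<^sup>2 = (F1 c / F0 c)\<^sup>2 - F2 c / F0 c"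
          using F0[of c] by (simp add: field_simps power2_eq_square)
        moreover have "?d = - v * h - v * x * (- (x / v) * h - h\<^sup>2) - 2 * v * v * h * (- (x / v) * h - h\<^sup>2)"
          by (simp only: x_def)
        moreover have "\<dots> = 2 * h * ((x + v * h)\<^sup>2 - (x * (x + v * h) + v) / 2)"
          using v by (simp add: field_simps power2_eq_square)
        ultimately show ?thesis by presburger
      qed
      moreover have "0 < 2 * h * (((F1 c)\<^sup>2 - F0 c * F2 c) / (F0 c)\<^sup>2)"
        using f[of c] F0[of c] K[of c] by (simp add: h_def H_def)
      ultimately show "\<exists>y. ((\<lambda>c. cond_var (normal_law m v) {..c}) has_real_derivative y) (at c) \<and> 0 < y"
        by metis
    qed
  qed
qed

section \<open>Closed form of the divergence\<close>

lemma expectation_normal_law: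
  assumes "0 < v"
  shows "(\<integral>x. x \<partial>normal_law m v) = m"
  using assms by (simp add: integral_normal_law integral_normal_moment_nz_1)

lemma integral_normal_law_square:
  assumes "0 < v"
  shows "(\<integral>x. (x - b)\<^sup>2 \<partial>normal_law m v) = v + (m - b)\<^sup>2"
proof -
  interpret prob_space "normal_law m v" by (rule prob_space_normal_law) (use assms in simp)
  have "(\<integral>x. (x - m)\<^sup>2 \<partial>normal_law m v) = v"
    using assms integral_normal_moment_even[of "sqrt v" m 1] by (simp add: integral_normal_law)
  then show ?thesis
    using integral_square_deviation[of "\<lambda>x. x" b] assms
    by (simp add: integrable_normal_law_moments expectation_normal_law)
qed

text \<open>Up to the constant $\ln (2 \pi) / 2$, the cross entropy relative to a normal density with
  variance $w$ of a law whose mean square deviation from the mean of that density is $a$.\<close>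

definition gauss_cross_entropy :: "real \<Rightarrow> real \<Rightarrow> real" where
  "gauss_cross_entropy a w = (ln w + a / w) / 2"

text \<open>With r = a / w, twice the gap is (r - 1 - ln r) + d^2 / w. Both summands are
  nonnegative, and ln r = r - 1 only for r = 1.\<close>

lemma gauss_cross_entropy_minimum:
  assumes "0 < a" "0 < w"
  shows "gauss_cross_entropy a a \<le> gauss_cross_entropy (a + d\<^sup>2) w"
    and "gauss_cross_entropy (a + d\<^sup>2) w \<le> gauss_cross_entropy a a \<Longrightarrow> w = a \<and> d = 0"
proof -
  define r q where "r = a / w" and "q = d\<^sup>2 / w"
  have eq: "2 * (gauss_cross_entropy (a + d\<^sup>2) w - gauss_cross_entropy a a) = (r - 1 - ln r) + q"
    using assms by (simp add: r_def q_def gauss_cross_entropy_def ln_div add_divide_distrib diff_divide_distrib)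
  have r: "0 < r" and le: "ln r \<le> r - 1" and q: "0 \<le> q"
    using assms by (auto simp: r_def q_def intro: ln_le_minus_one)
  show "gauss_cross_entropy a a \<le> gauss_cross_entropy (a + d\<^sup>2) w"
    using eq le q by simp
  assume "gauss_cross_entropy (a + d\<^sup>2) w \<le> gauss_cross_entropy a a"
  with eq have "(r - 1 - ln r) + q \<le> 0" by simp
  with le q have "q = 0" "ln r = r - 1" by linarith+
  then show "w = a \<and> d = 0"
    using assms ln_eq_minus_one[OF r] by (simp add: r_def q_def)
qed

text \<open>The divergence of two normal laws as cross entropy minus entropy. The log ratio is
  quadratic in \<open>x\<close>, so only mean square deviations enter.\<close>

lemma integral_ln_normal_pdf_ratio:
  assumes "0 < v" "0 < w"
  shows "integrable (normal_law a v) (\<lambda>x. ln (normal_pdf a v x / normal_pdf b w x))"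
    and "(\<integral>x. ln (normal_pdf a v x / normal_pdf b w x) \<partial>normal_law a v) =
      gauss_cross_entropy (v + (a - b)\<^sup>2) w - gauss_cross_entropy v v"
proof -
  interpret prob_space "normal_law a v" by (rule prob_space_normal_law) (use assms in simp)
  note int = integrable_normal_law_square[OF assms(1), of a]
  show "integrable (normal_law a v) (\<lambda>x. ln (normal_pdf a v x / normal_pdf b w x))"
    unfolding ln_normal_pdf_ratio[OF assms]
    by (intro Bochner_Integration.integrable_diff Bochner_Integration.integrable_add
        integrable_divide_zero int integrable_const)
  have "(\<integral>x. ln (normal_pdf a v x / normal_pdf b w x) \<partial>normal_law a v) =
      (ln w - ln v) / 2 + (v + (a - b)\<^sup>2) / (2 * w) - v / (2 * v)"
    unfolding ln_normal_pdf_ratio[OF assms]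
    using int prob_space by (simp add: integral_normal_law_square[OF assms(1)])
  then show "(\<integral>x. ln (normal_pdf a v x / normal_pdf b w x) \<partial>normal_law a v) =
      gauss_cross_entropy (v + (a - b)\<^sup>2) w - gauss_cross_entropy v v"
    using assms by (simp add: gauss_cross_entropy_def field_simps)
qed

text \<open>For a fixed first draw \<open>x\<close> the log ratio of an uncensored pair is a sum
  \<open>l1 x + l2 x y\<close>, and integrating out the second draw leaves
  \<open>l1 x + k x\<close>. The \<open>l1\<close> part is then collected over the whole line and
  the \<open>k\<close> part over the uncensored ray.\<close>

lemma D_KL_history_eq:
  fixes \<mu>1 \<mu>2 v m1 m2 v1 v2 \<gamma> c :: real
  defines "N1 \<equiv> normal_law \<mu>1 v"
  assumes v: "0 < v" "0 < v1" "0 < v2"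
  shows "D_KL (history (Psi \<mu>1 \<mu>2 v v 0) c) (history (Psi m1 m2 v1 v2 \<gamma>) c) = ereal (
    gauss_cross_entropy (v + (\<mu>1 - m1)\<^sup>2) v1 - gauss_cross_entropy v v +
    measure N1 {..c} * (gauss_cross_entropy
      (v + \<gamma>\<^sup>2 * cond_var N1 {..c} + (\<mu>2 - m2 + \<gamma> * (cond_mean N1 {..c} - m1))\<^sup>2) v2 - gauss_cross_entropy v v))"
proof -
  let ?N2 = "normal_law \<mu>2 v" and ?T = "uniform_measure N1 {..c}"
  let ?E = "cond_mean N1 {..c}" and ?V = "cond_var N1 {..c}" and ?p = "measure N1 {..c}"
  interpret N1: prob_space N1 unfolding N1_def by (rule prob_space_normal_law) (use v in simp)
  interpret N2: prob_space ?N2 by (rule prob_space_normal_law) (use v in simp)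
  have [simp, measurable_cong]: "sets N1 = sets borel" by (simp add: N1_def)
  have ne: "emeasure N1 {..c} \<noteq> 0"
    unfolding N1_def by (rule emeasure_normal_law_atMost[OF v(1)])
  interpret T: prob_space ?T by (rule prob_space_uniform_measure) (use ne in auto)
  define l1 where "l1 x = ln (normal_pdf \<mu>1 v x / normal_pdf m1 v1 x)" for x
  define l2 where "l2 x y = ln (normal_pdf \<mu>2 v y / normal_pdf (m2 - \<gamma> * (x - m1)) v2 y)" for x y
  \<comment> \<open>The divergence in the second draw given \<open>x\<close>, where the subjective
    mean is off by \<open>\<mu>2 - m2 + \<gamma> * (x - m1)\<close>.\<close>
  define k where "k x = gauss_cross_entropy (v + (\<mu>2 - m2 + \<gamma> * (x - m1))\<^sup>2) v2 - gauss_cross_entropy v v" for x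
  have [measurable]: "l1 \<in> borel_measurable borel" "k \<in> borel_measurable borel"
    unfolding l1_def k_def gauss_cross_entropy_def by measurable
  have l1_int: "integrable N1 l1"
    unfolding N1_def l1_def[abs_def] by (rule integral_ln_normal_pdf_ratio(1)[OF v(1,2)])
  have set_int: "set_integrable N1 A h" if "integrable N1 h" "A \<in> sets borel" for A and h :: "real \<Rightarrow> real"
    unfolding set_integrable_def by (rule integrable_mult_indicator[OF _ that(1)]) (use that in simp)

  have "(LINT y|lborel. normal_pdf \<mu>1 v x * normal_pdf \<mu>2 v y *
      ln (normal_pdf \<mu>1 v x * normal_pdf \<mu>2 v y /
        (normal_pdf m1 v1 x * normal_pdf (m2 - \<gamma> * (x - m1)) v2 y))) = normal_pdf \<mu>1 v x * (l1 x + k x)" for x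
  proof -
    have "ln (normal_pdf \<mu>1 v x * normal_pdf \<mu>2 v y /
        (normal_pdf m1 v1 x * normal_pdf (m2 - \<gamma> * (x - m1)) v2 y)) = l1 x + l2 x y" for y
    proof -
      have "0 < normal_pdf \<mu>1 v x" "0 < normal_pdf \<mu>2 v y" "0 < normal_pdf m1 v1 x"
        "0 < normal_pdf (m2 - \<gamma> * (x - m1)) v2 y"
        using v by (auto intro: normal_density_pos)
      then show ?thesis by (simp add: l1_def l2_def ln_div ln_mult)
    qed
    then have "(LINT y|lborel. normal_pdf \<mu>1 v x * normal_pdf \<mu>2 v y *
        ln (normal_pdf \<mu>1 v x * normal_pdf \<mu>2 v y /
          (normal_pdf m1 v1 x * normal_pdf (m2 - \<gamma> * (x - m1)) v2 y))) =
        normal_pdf \<mu>1 v x * (LINT y|lborel. normal_pdf \<mu>2 v y * (l1 x + l2 x y))"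
      by (simp add: mult.assoc)
    also have "(LINT y|lborel. normal_pdf \<mu>2 v y * (l1 x + l2 x y)) = (\<integral>y. l1 x + l2 x y \<partial>?N2)"
      by (rule integral_normal_law[OF v(1), symmetric]) (simp add: l2_def)
    also have "\<dots> = l1 x + k x"
      using integral_ln_normal_pdf_ratio[OF v(1,3), of \<mu>2 "m2 - \<gamma> * (x - m1)"] N2.prob_space
      by (simp add: l2_def k_def algebra_simps)
    finally show ?thesis .
  qed
  then have "D_KL (history (Psi \<mu>1 \<mu>2 v v 0) c) (history (Psi m1 m2 v1 v2 \<gamma>) c) = ereal (
      (LINT x:{c<..}|lborel. normal_pdf \<mu>1 v x * l1 x) +
      (LINT x:{..c}|lborel. normal_pdf \<mu>1 v x * (l1 x + k x)))"
    unfolding D_KL_history[OF v] by (simp add: l1_def)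
  also have "(LINT x:{c<..}|lborel. normal_pdf \<mu>1 v x * l1 x) = (LINT x:{c<..}|N1. l1 x)"
    unfolding N1_def by (rule set_integral_normal_law[OF v(1), symmetric]) auto
  also have "(LINT x:{..c}|lborel. normal_pdf \<mu>1 v x * (l1 x + k x)) = (LINT x:{..c}|N1. l1 x + k x)"
    unfolding N1_def by (rule set_integral_normal_law[OF v(1), symmetric]) auto
  also have "(LINT x:{..c}|N1. l1 x + k x) = (LINT x:{..c}|N1. l1 x) + (LINT x:{..c}|N1. k x)"
  proof (rule set_integral_add(2))
    have "integrable N1 (\<lambda>x. (x - m1)\<^sup>2)"
      unfolding N1_def by (rule integrable_normal_law_square[OF v(1)])
    moreover have "integrable N1 (\<lambda>x. x)"
      unfolding N1_def by (rule integrable_normal_law_moments[OF v(1)])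
    ultimately have "integrable N1 k"
      unfolding k_def gauss_cross_entropy_def power2_sum power_mult_distrib by simp
    then show "set_integrable N1 {..c} k" by (rule set_int) simp
  qed (intro set_int l1_int, simp)
  also have "(LINT x:{..c}|N1. k x) = ?p * (\<integral>x. k x \<partial>?T)"
    using N1.integral_uniform_measure[OF ne, of k] measure_normal_law_atMost_pos[OF v(1), of \<mu>1 c]
    by (simp add: N1_def)
  also have "(\<integral>x. k x \<partial>?T) = gauss_cross_entropy (v + \<gamma>\<^sup>2 * ?V + (\<mu>2 - m2 + \<gamma> * (?E - m1))\<^sup>2) v2
      - gauss_cross_entropy v v"
  proof -
    note int = integrable_normal_law_moments[OF v(1), of \<mu>1, folded N1_def]
      integrable_normal_law_square[OF v(1), of \<mu>1, folded N1_def]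
    have "{..c} \<in> sets N1" by simp
    note intT = int[THEN N1.integrable_uniform_measure[OF ne this]]
    define e where "e = \<mu>2 - m2 + \<gamma> * (?E - m1)"
    \<comment> \<open>Recentring at the conditional mean: the linear term averages to zero, leaving
      the conditional variance times \<open>\<gamma>\<^sup>2\<close> plus the squared average error
      \<open>e\<close>.\<close>
    have sq: "(\<mu>2 - m2 + \<gamma> * (x - m1))\<^sup>2 = \<gamma>\<^sup>2 * (x - ?E)\<^sup>2 + 2 * \<gamma> * e * (x - ?E) + e\<^sup>2" for x
      by (simp add: e_def power2_eq_square algebra_simps)
    have int_dev: "integrable ?T (\<lambda>x. x - ?E)"
      by (intro Bochner_Integration.integrable_diff intT T.integrable_const)
    have "(\<integral>x. x - ?E \<partial>?T) = 0"
      using intT(1) T.prob_space by (simp add: cond_mean_def)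
    then have "(\<integral>x. (\<mu>2 - m2 + \<gamma> * (x - m1))\<^sup>2 \<partial>?T) = \<gamma>\<^sup>2 * (\<integral>x. (x - ?E)\<^sup>2 \<partial>?T) + e\<^sup>2"
      unfolding sq using intT(3)[of ?E] int_dev T.prob_space by simp
    moreover have "integrable ?T (\<lambda>x. (\<mu>2 - m2 + \<gamma> * (x - m1))\<^sup>2)"
      unfolding sq using intT(3)[of ?E] int_dev by simp
    ultimately show ?thesis
      using T.prob_space by (simp add: k_def gauss_cross_entropy_def e_def cond_var_def[symmetric] add.assoc)
  qed
  \<comment> \<open>The first draw is observed on both sides of \<open>c\<close>, so its
    contributions recombine.\<close>
  also have "(LINT x:{c<..}|N1. l1 x) + ((LINT x:{..c}|N1. l1 x) + q) = (\<integral>x. l1 x \<partial>N1) + q" for q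
  proof -
    have "(LINT x:{c<..} \<union> {..c}|N1. l1 x) = (LINT x:{c<..}|N1. l1 x) + (LINT x:{..c}|N1. l1 x)"
      by (rule set_integral_Un) (auto intro!: set_int l1_int)
    moreover have "{c<..} \<union> {..c} = UNIV" by auto
    ultimately show ?thesis by (simp add: set_lebesgue_integral_def)
  qed
  also have "(\<integral>x. l1 x \<partial>N1) = gauss_cross_entropy (v + (\<mu>1 - m1)\<^sup>2) v1 - gauss_cross_entropy v v"
    unfolding N1_def l1_def by (rule integral_ln_normal_pdf_ratio(2)[OF v(1,2)])
  finally show ?thesis .
qed

section \<open>Minimisation over the subjective parameters\<close>

lemma cond_var_nonneg: "0 \<le> cond_var P A"
  by (simp add: cond_var_def)

text \<open>A zero variance costs infinity, while the candidate has finite divergence. Otherwise the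
  excess is a gap in the first draw plus \<open>p\<close> times a gap in the second; both are
  nonnegative, \<open>p\<close> is positive, and they vanish together only at the candidate.\<close>

lemma D_KL_history_strict_minimum:
  fixes \<mu>1 \<mu>2 v \<gamma> c :: real
  defines "E \<equiv> cond_mean (normal_law \<mu>1 v) {..c}" and "S \<equiv> v + \<gamma>\<^sup>2 * cond_var (normal_law \<mu>1 v) {..c}"
  assumes "0 < v" "0 \<le> v1" "0 \<le> v2" and "(m1, m2, v1, v2) \<noteq> (\<mu>1, \<mu>2 - \<gamma> * (\<mu>1 - E), v, S)"
  shows "D_KL (history (Psi \<mu>1 \<mu>2 v v 0) c) (history (Psi \<mu>1 (\<mu>2 - \<gamma> * (\<mu>1 - E)) v S \<gamma>) c)
    < D_KL (history (Psi \<mu>1 \<mu>2 v v 0) c) (history (Psi m1 m2 v1 v2 \<gamma>) c)"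
proof -
  define p where "p = measure (normal_law \<mu>1 v) {..c}"
  have S: "0 < S" using assms(3) by (simp add: S_def cond_var_nonneg add_pos_nonneg)
  have p: "0 < p" unfolding p_def by (rule measure_normal_law_atMost_pos) fact
  \<comment> \<open>At the candidate both mean errors are zero and \<open>v1 = v\<close>, so the
    first-draw term drops out.\<close>
  have opt: "D_KL (history (Psi \<mu>1 \<mu>2 v v 0) c) (history (Psi \<mu>1 (\<mu>2 - \<gamma> * (\<mu>1 - E)) v S \<gamma>) c) =
      ereal (p * (gauss_cross_entropy S S - gauss_cross_entropy v v))"
    using D_KL_history_eq[OF assms(3,3) S] by (simp add: E_def[symmetric] S_def[symmetric] p_def algebra_simps)
  show ?thesis
  proof (cases "v1 = 0 \<or> v2 = 0")
    case True
    then show ?thesis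
      using D_KL_history_degenerate[OF assms(3-5) True] by (simp add: opt)
  next
    case False
    then have pos: "0 < v1" "0 < v2" using assms by auto
    define d where "d = \<mu>2 - m2 + \<gamma> * (E - m1)"
    have eq: "D_KL (history (Psi \<mu>1 \<mu>2 v v 0) c) (history (Psi m1 m2 v1 v2 \<gamma>) c) = ereal (
        gauss_cross_entropy (v + (\<mu>1 - m1)\<^sup>2) v1 - gauss_cross_entropy v v +
        p * (gauss_cross_entropy (S + d\<^sup>2) v2 - gauss_cross_entropy v v))"
      using D_KL_history_eq[OF assms(3) pos] by (simp add: E_def S_def d_def p_def)
    note 1 = gauss_cross_entropy_minimum[OF assms(3) pos(1), of "\<mu>1 - m1"]
    note 2 = gauss_cross_entropy_minimum[OF S pos(2), of d]
    \<comment> \<open>Once \<open>m1 = \<mu>1\<close>, the condition \<open>d = 0\<close> determines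
      \<open>m2\<close>, so these four equations single out the candidate.\<close>
    have "\<not> (m1 = \<mu>1 \<and> v1 = v \<and> d = 0 \<and> v2 = S)"
      using assms(6) by (auto simp: d_def algebra_simps)
    then have "gauss_cross_entropy v v < gauss_cross_entropy (v + (\<mu>1 - m1)\<^sup>2) v1 \<or>
        gauss_cross_entropy S S < gauss_cross_entropy (S + d\<^sup>2) v2"
      using 1(2) 2(2) by force
    then have "0 < (gauss_cross_entropy (v + (\<mu>1 - m1)\<^sup>2) v1 - gauss_cross_entropy v v) +
        p * (gauss_cross_entropy (S + d\<^sup>2) v2 - gauss_cross_entropy S S)"
      using 1(1) 2(1) p by (auto intro: add_pos_nonneg add_nonneg_pos)
    then show ?thesis unfolding opt eq by (simp add: algebra_simps)
  qed
qed

text \<open>The strict inequality disqualifies every other feasible point, and by asymmetry of the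
  order none of them beats \<open>t\<close>.\<close>

lemma is_arg_min_eq_singleton:
  fixes f :: "'a \<Rightarrow> 'b::order"
  assumes "P t" and "\<And>x. P x \<Longrightarrow> x \<noteq> t \<Longrightarrow> f t < f x"
  shows "{x. is_arg_min f P x} = {t}"
proof -
  have "is_arg_min f P x \<longleftrightarrow> x = t" for x
    unfolding is_arg_min_def using assms by (metis less_asym)
  then show ?thesis by auto
qed

theorem proposition5:
  fixes \<mu>1 \<mu>2 v \<gamma> :: real
  assumes "v > 0" and "\<gamma> > 0"
  shows "(\<forall>c. {\<theta>. is_arg_min
              (\<lambda>(m1, m2, v1, v2).
                 D_KL (history (Psi \<mu>1 \<mu>2 v v 0) c) (history (Psi m1 m2 v1 v2 \<gamma>) c))
              (\<lambda>(m1, m2, v1, v2). v1 \<ge> 0 \<and> v2 \<ge> 0) \<theta>} =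
            {(\<mu>1,
              \<mu>2 - \<gamma> * (\<mu>1 - cond_mean (normal_law \<mu>1 v) {..c}),
              v,
              v + \<gamma>\<^sup>2 * cond_var (normal_law \<mu>1 v) {..c})}) \<and>
         strict_mono (\<lambda>c. v + \<gamma>\<^sup>2 * cond_var (normal_law \<mu>1 v) {..c})"
proof (intro conjI allI is_arg_min_eq_singleton)
  fix c
  show "case (\<mu>1, \<mu>2 - \<gamma> * (\<mu>1 - cond_mean (normal_law \<mu>1 v) {..c}), v,
      v + \<gamma>\<^sup>2 * cond_var (normal_law \<mu>1 v) {..c}) of (m1, m2, v1, v2) \<Rightarrow> v1 \<ge> 0 \<and> v2 \<ge> 0"
    using assms by (simp add: cond_var_nonneg)
next
  fix c and \<theta> :: "real \<times> real \<times> real \<times> real"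
  obtain m1 m2 v1 v2 where \<theta>: "\<theta> = (m1, m2, v1, v2)" by (metis prod.collapse)
  assume "case \<theta> of (m1, m2, v1, v2) \<Rightarrow> v1 \<ge> 0 \<and> v2 \<ge> 0"
    and "\<theta> \<noteq> (\<mu>1, \<mu>2 - \<gamma> * (\<mu>1 - cond_mean (normal_law \<mu>1 v) {..c}), v,
      v + \<gamma>\<^sup>2 * cond_var (normal_law \<mu>1 v) {..c})"
  then show "(case (\<mu>1, \<mu>2 - \<gamma> * (\<mu>1 - cond_mean (normal_law \<mu>1 v) {..c}), v,
      v + \<gamma>\<^sup>2 * cond_var (normal_law \<mu>1 v) {..c}) of (m1, m2, v1, v2) \<Rightarrow>
        D_KL (history (Psi \<mu>1 \<mu>2 v v 0) c) (history (Psi m1 m2 v1 v2 \<gamma>) c))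
      < (case \<theta> of (m1, m2, v1, v2) \<Rightarrow>
        D_KL (history (Psi \<mu>1 \<mu>2 v v 0) c) (history (Psi m1 m2 v1 v2 \<gamma>) c))"
    unfolding \<theta> prod.case using assms by (intro D_KL_history_strict_minimum) auto
next
  show "strict_mono (\<lambda>c. v + \<gamma>\<^sup>2 * cond_var (normal_law \<mu>1 v) {..c})"
    using strict_mono_cond_var_normal_law_atMost[OF assms(1), of \<mu>1] assms(2)
    by (simp add: strict_mono_def)
qed

end
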